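(* The following is a complete list of the three-dimensional solvable real Lie subalgebras of $\mathfrak{su}(2,1)$ up to conjugation in $\mathrm{SU}(2,1)$: (1) $\mathfrak{v}_{3,1}=\langle A_4-A_8,\;A_3+A_7,\;A_1+A_2-A_6\rangle$; (2) $\mathfrak{v}_{3,2}=\langle A_3+A_4+A_7-A_8,\;A_1+A_2-A_6,\;A_5\rangle$; (3) $\mathfrak{v}_{3,3}=\langle 4A_4-\sqrt2A_6+\sqrt2A_8,\;A_5-A_7,\;A_1+2A_2+3A_4\rangle$. That is, every three-dimensional solvable real subalgebra of $\mathfrak{su}(2,1)$ is conjugate under $\mathrm{SU}(2,1)$ to one of these three, and these three are pairwise non-conjugate under $\mathrm{SU}(2,1)$.
   Context: Let $N=\mathrm{diag}(1,1,-1)$. $\mathfrak{su}(2,1)$ is the real Lie algebra of traceless complex $3\times3$ matrices $x$ with $-N\bar x^{t}N^{-1}=x$, and $\mathrm{SU}(2,1)$ is the group of $g\in\mathrm{SL}_3(\mathbb{C})$ with $N(\bar g^{t})^{-1}N^{-1}=g$. $\mathrm{SU}(2,1)$ acts on subalgebras by $g\cdot\mathfrak{v}=g\mathfrak{v}g^{-1}$; conjugate means lying in the same orbit. With $E_{ij}$ the matrix units, the real basis of $\mathfrak{su}(2,1)$ used is $A_1=i(E_{11}-E_{22})$, $A_2=i(E_{22}-E_{33})$, $A_3=E_{12}-E_{21}$, $A_4=i(E_{12}+E_{21})$, $A_5=E_{13}+E_{31}$, $A_6=i(E_{13}-E_{31})$, $A_7=E_{23}+E_{32}$, $A_8=i(E_{23}-E_{32})$.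 $\langle\cdots\rangle$ denotes the real linear span. *)

theory Defs
  imports "HOL-Analysis.Analysis"
begin

type_synonym cmat3 = "complex ^ 3 ^ 3"

definition ctranspose :: "cmat3 \<Rightarrow> cmat3" where
  "ctranspose x = transpose (map_matrix cnj x)"

(* In the index type 3 the numeral 3 equals 0; the three indices are 1, 2, 3. *)
definition N :: cmat3 where
  "N = (\<chi> i j. if i = j then (if i = 3 then -1 else 1) else 0)"

definition su21 :: "cmat3 set" where
  "su21 = {x. trace x = 0 \<and> - (N ** ctranspose x ** matrix_inv N) = x}"

(* matrix_inv is unspecified on singular matrices, but det g = 1 makes ctranspose g invertible. *)
definition SU21 :: "cmat3 set" where
  "SU21 = {g. det g = 1 \<and> N ** matrix_inv (ctranspose g) ** matrix_inv N = g}"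

definition bracket :: "cmat3 \<Rightarrow> cmat3 \<Rightarrow> cmat3" where
  "bracket x y = x ** y - y ** x"

(* subspace, span and dim are the library's notions over the reals, with complex matrices
   regarded as a real vector space. *)
definition lie_subalgebra_su21 :: "cmat3 set \<Rightarrow> bool" where
  "lie_subalgebra_su21 v \<longleftrightarrow>
     v \<subseteq> su21 \<and> subspace v \<and> (\<forall>x\<in>v. \<forall>y\<in>v. bracket x y \<in> v)"

definition derived_algebra :: "cmat3 set \<Rightarrow> cmat3 set" where
  "derived_algebra v = span {bracket x y | x y. x \<in> v \<and> y \<in> v}"

definition solvable_lie :: "cmat3 set \<Rightarrow> bool" where
  "solvable_lie v \<longleftrightarrow> (\<exists>n. (derived_algebra ^^ n) v = {0})"

definition solvable_subalgebra3 :: "cmat3 set \<Rightarrow> bool" where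
  "solvable_subalgebra3 v \<longleftrightarrow> lie_subalgebra_su21 v \<and> solvable_lie v \<and> dim v = 3"

definition act :: "cmat3 \<Rightarrow> cmat3 set \<Rightarrow> cmat3 set" where
  "act g v = (\<lambda>x. g ** x ** matrix_inv g) ` v"

definition conjugate_SU21 :: "cmat3 set \<Rightarrow> cmat3 set \<Rightarrow> bool" where
  "conjugate_SU21 v w \<longleftrightarrow> (\<exists>g\<in>SU21. act g v = w)"

definition matrix_unit :: "3 \<Rightarrow> 3 \<Rightarrow> cmat3" where
  "matrix_unit a b = (\<chi> i j. if i = a \<and> j = b then 1 else 0)"

definition i_times :: "cmat3 \<Rightarrow> cmat3" where
  "i_times x = map_matrix (\<lambda>z. \<i> * z) x"

definition A1 :: cmat3 where "A1 = i_times (matrix_unit 1 1 - matrix_unit 2 2)"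
definition A2 :: cmat3 where "A2 = i_times (matrix_unit 2 2 - matrix_unit 3 3)"
definition A3 :: cmat3 where "A3 = matrix_unit 1 2 - matrix_unit 2 1"
definition A4 :: cmat3 where "A4 = i_times (matrix_unit 1 2 + matrix_unit 2 1)"
definition A5 :: cmat3 where "A5 = matrix_unit 1 3 + matrix_unit 3 1"
definition A6 :: cmat3 where "A6 = i_times (matrix_unit 1 3 - matrix_unit 3 1)"
definition A7 :: cmat3 where "A7 = matrix_unit 2 3 + matrix_unit 3 2"
definition A8 :: cmat3 where "A8 = i_times (matrix_unit 2 3 - matrix_unit 3 2)"

definition v31 :: "cmat3 set" where
  "v31 = span {A4 - A8, A3 + A7, A1 + A2 - A6}"

definition v32 :: "cmat3 set" where
  "v32 = span {A3 + A4 + A7 - A8, A1 + A2 - A6, A5}"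

definition v33 :: "cmat3 set" where
  "v33 = span {4 *\<^sub>R A4 - sqrt 2 *\<^sub>R A6 + sqrt 2 *\<^sub>R A8, A5 - A7, A1 + 2 *\<^sub>R A2 + 3 *\<^sub>R A4}"

end

(*
By Lie's theorem, a solvable subalgebra v has a common eigenvector in every v-invariant complex
subspace of C^3.  The orthogonal complement (for the invariant Hermitian form) of common
eigenvectors is invariant.  If no common eigenvector were isotropic, one would find an orthogonal
basis of common eigenvectors with imaginary eigenvalues of sum zero, and v would have dimension at
most 2.  So v fixes an isotropic line, which SU(2,1) moves to the line of (1,0,1), and v lies in the
five-dimensional stabiliser: two parameters (a, m) for the split and the compact part of the
torus, and a three-dimensional Heisenberg algebra (c, z).  Either v is the Heisenberg algebra, or v
contains an element with (a, m) nonzero whose c-component is removed by a unipotent conjugation;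
brackets with it and the dimension 3 force the other two types.  The function trace(x^2) =
2 a^2 - 6 m^2 distinguishes the three types: zero, nonnegative and nonzero, indefinite.
*)

theory Submission
  imports Defs "HOL-Computational_Algebra.Fundamental_Theorem_Algebra"
begin

section \<open>Entrywise arithmetic of 3 by 3 matrices\<close>

lemma bracket_mult_vec:
  "bracket x y *v u = x *v (y *v u) - y *v (x *v u)"
  by (simp add: bracket_def matrix_vector_mult_diff_rdistrib matrix_vector_mul_assoc)

lemma vec3_eq_iff: "u = v \<longleftrightarrow> u$1 = v$1 \<and> u$2 = v$2 \<and> u$3 = v$3"
  for u v :: "'a^3"
  by (simp add: vec_eq_iff forall_3)

lemma mat3_eq_iff: "x = y \<longleftrightarrow> x$1$1 = y$1$1 \<and> x$1$2 = y$1$2 \<and> x$1$3 = y$1$3 \<and>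
   x$2$1 = y$2$1 \<and> x$2$2 = y$2$2 \<and> x$2$3 = y$2$3 \<and>
   x$3$1 = y$3$1 \<and> x$3$2 = y$3$2 \<and> x$3$3 = y$3$3"
  for x y :: "'a^3^3"
  by (auto simp: vec3_eq_iff)

lemma mult_vec_nth3: "(x *v u) $ i = x$i$1 * u$1 + x$i$2 * u$2 + x$i$3 * u$3"
  for x :: "'a::comm_ring_1^3^3"
  by (simp add: matrix_vector_mult_def sum_3)

lemma mult_mat_nth3: "(x ** y) $ i $ j = x$i$1 * y$1$j + x$i$2 * y$2$j + x$i$3 * y$3$j"
  for x :: "'a::comm_ring_1^3^3"
  by (simp add: matrix_matrix_mult_def sum_3)

lemma mult_mat_scaleR_left: "(c *\<^sub>R x) ** y = c *\<^sub>R (x ** y)" for x :: cmat3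
  by (simp add: vec_eq_iff mult_mat_nth3 algebra_simps)

lemma mult_mat_scaleR_right: "x ** (c *\<^sub>R y) = c *\<^sub>R (x ** y)" for x :: cmat3
  by (simp add: vec_eq_iff mult_mat_nth3 algebra_simps)

lemma scaleR_mult_vec: "(c *\<^sub>R x) *v u = complex_of_real c *s (x *v u)" for x :: cmat3
  by (simp add: vec_eq_iff mult_vec_nth3 scaleR_conv_of_real[of _ "_ :: complex"] algebra_simps)

section \<open>Lie's theorem\<close>

text \<open>The coefficients are those of the characteristic polynomial: determinant, minus the sum
  of the principal 2 by 2 minors, and trace. They do not depend on \<open>w\<close>, so the identity
  can be expanded in coordinates.\<close>

lemma Cayley_Hamilton_3_vec:
  fixes x :: "'a::comm_ring_1^3^3"
  shows "\<exists>a b c. \<forall>w. x *v (x *v (x *v w)) = a *s w + b *s (x *v w) + c *s (x *v (x *v w))"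
proof -
  have "x *v (x *v (x *v w)) = det x *s w
      + (x$1$2 * x$2$1 + x$1$3 * x$3$1 + x$2$3 * x$3$2
         - x$1$1 * x$2$2 - x$1$1 * x$3$3 - x$2$2 * x$3$3) *s (x *v w)
      + (x$1$1 + x$2$2 + x$3$3) *s (x *v (x *v w))" for w
    by (simp add: vec3_eq_iff mult_vec_nth3 det_3) (simp add: algebra_simps)
  then show ?thesis by blast
qed

text \<open>Case split on the degree (1, 2 or 3) of the minimal polynomial of \<open>w\<close> under
  \<open>x\<close>. The independence clauses allow coefficients to be compared later.\<close>

lemma krylov_cases:
  fixes x :: "'a::field^3^3"
  assumes "w \<noteq> 0"
  obtains (one) a where "x *v w = a *s w"
  | (two) a b where "x *v (x *v w) = a *s w + b *s (x *v w)"
      "\<And>p q. p *s w + q *s (x *v w) = 0 \<Longrightarrow> p = 0 \<and> q = 0"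
  | (three) a b c where "x *v (x *v (x *v w)) = a *s w + b *s (x *v w) + c *s (x *v (x *v w))"
      "\<And>p q r. p *s w + q *s (x *v w) + r *s (x *v (x *v w)) = 0 \<Longrightarrow> p = 0 \<and> q = 0 \<and> r = 0"
proof -
  \<comment> \<open>The top coefficient of a shortest relation is nonzero, so the relation can be
    solved for the highest power of \<open>x\<close> applied to \<open>w\<close>.\<close>
  have c1: "\<exists>a. x *v w = a *s w" if "p *s w + q *s (x *v w) = 0" "\<not> (p = 0 \<and> q = 0)" for p q
  proof -
    have "q \<noteq> 0"
      using that assms by auto
    then have "x *v w = (- p / q) *s w"
      using that(1) by (simp add: vec_eq_iff field_simps) (metis add.commute add_eq_0_iff)
    then show ?thesis by blast
  qed
  have c2: "\<exists>a b. x *v (x *v w) = a *s w + b *s (x *v w)"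
    if "p *s w + q *s (x *v w) + r *s (x *v (x *v w)) = 0" "r \<noteq> 0" for p q r
  proof -
    have "n = (- p / r) * l + (- q / r) * m" if "p * l + q * m + r * n = 0" for l m n
    proof -
      have "r * n = - (p * l) - q * m" using that by algebra
      then have "n = (- (p * l) - q * m) / r" using \<open>r \<noteq> 0\<close> by (metis nonzero_mult_div_cancel_left)
      then show ?thesis by (simp add: diff_divide_distrib)
    qed
    then have "x *v (x *v w) = (- p / r) *s w + (- q / r) *s (x *v w)"
      using that(1) by (simp add: vec_eq_iff)
    then show ?thesis by blast
  qed
  show ?thesis
  proof (cases "\<exists>p q. p *s w + q *s (x *v w) = 0 \<and> \<not> (p = 0 \<and> q = 0)")
    case True
    then show ?thesis using c1 one by blast
  next
    case i2: False
    show ?thesis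
    proof (cases "\<exists>p q r. p *s w + q *s (x *v w) + r *s (x *v (x *v w)) = 0 \<and> \<not> (p = 0 \<and> q = 0 \<and> r = 0)")
      case True
      then obtain p q r where pqr: "p *s w + q *s (x *v w) + r *s (x *v (x *v w)) = 0"
          "\<not> (p = 0 \<and> q = 0 \<and> r = 0)" by blast
      have "r \<noteq> 0"
        using pqr i2 by auto
      then show ?thesis using c2[OF pqr(1)] two i2 by blast
    next
      case False
      then show ?thesis using Cayley_Hamilton_3_vec[of x] three by blast
    qed
  qed
qed

text \<open>Over the complex numbers the minimal polynomial of \<open>w\<close> has a root
  \<open>r\<close>. If \<open>q\<close> is its cofactor after removing the factor
  \<open>X - r\<close>, then \<open>q\<close> evaluated at \<open>x\<close> and applied to
  \<open>w\<close> is an eigenvector: it lies in \<open>W\<close> by invariance and is nonzero by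
  minimality of the degree.\<close>

lemma eigenvector_in_invariant_subspace:
  fixes x :: cmat3
  assumes W: "vec.subspace W" "\<And>u. u \<in> W \<Longrightarrow> x *v u \<in> W" and w: "w \<in> W" "w \<noteq> 0"
  shows "\<exists>u\<in>W. u \<noteq> 0 \<and> (\<exists>r. x *v u = r *s u)"
  using w(2)
proof (cases rule: krylov_cases[where x = x])
  case (one a)
  then show ?thesis using w by blast
next
  case (two a b)
  have "\<not> constant (poly [:-a, -b, 1:])"
    by (simp add: constant_degree)
  then obtain r where "poly [:-a, -b, 1:] r = 0"
    using fundamental_theorem_of_algebra by blast
  then have r: "a = r * r - b * r" by (simp add: algebra_simps)
  let ?u = "(r - b) *s w + 1 *s (x *v w)"
  have "x *v ?u = r *s ?u"
    by (simp add: matrix_vector_right_distrib vector_scalar_commute two(1)) (simp add: r vector_scalar_commute vec_eq_iff algebra_simps)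
  moreover have "?u \<noteq> 0" using two(2)[of "r - b" 1] by auto
  moreover have "?u \<in> W" by (intro vec.subspace_add vec.subspace_scale W w)
  ultimately show ?thesis by blast
next
  case (three a b c)
  have "\<not> constant (poly [:-a, -b, -c, 1:])"
    by (simp add: constant_degree)
  then obtain r where "poly [:-a, -b, -c, 1:] r = 0"
    using fundamental_theorem_of_algebra by blast
  then have r: "a = r * (r * r - c * r - b)" by (simp add: algebra_simps)
  \<comment> \<open>The coefficients come from dividing the cubic by \<open>X - r\<close>; the
    remainder vanishes by \<open>r\<close>.\<close>
  let ?u = "(r * r - c * r - b) *s w + (r - c) *s (x *v w) + 1 *s (x *v (x *v w))"
  have "x *v ?u = r *s ?u"
    by (simp add: matrix_vector_right_distrib vector_scalar_commute three(1)) (simp add: r vector_scalar_commute vec_eq_iff algebra_simps)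
  moreover have "?u \<noteq> 0" using three(2) zero_neq_one by metis
  moreover have "?u \<in> W" by (intro vec.subspace_add vec.subspace_scale W w)
  ultimately show ?thesis by blast
qed

text \<open>Key step of Lie's theorem. On the Krylov space of \<open>w\<close>, of dimension n, the
  commutator \<open>bracket x y\<close> has trace 0, yet it is triangular with every diagonal entry
  equal to its weight. In place of traces, its action on the top Krylov vector is computed in two
  ways; the top coefficients differ by n times the weight.\<close>

lemma weight_bracket_eq_0:
  fixes x :: cmat3 and wt :: "cmat3 \<Rightarrow> complex"
  assumes h: "\<And>y. y \<in> h \<Longrightarrow> bracket x y \<in> h"
    and wt: "\<And>y. y \<in> h \<Longrightarrow> y *v w = wt y *s w" and w: "w \<noteq> 0" and y: "y \<in> h"
  shows "wt (bracket x y) = 0"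
proof -
  \<comment> \<open>\<open>y1\<close> and \<open>y2\<close> express the triangular action of
    \<open>h\<close> on the first and second Krylov vectors.\<close>
  have y1: "y *v (x *v w) = wt y *s (x *v w) - wt (bracket x y) *s w" if "y \<in> h" for y
    using bracket_mult_vec[of x y w] wt[OF h[OF that]] wt[OF that]
    by (simp add: vector_scalar_commute algebra_simps)
  have y2: "y *v (x *v (x *v w)) = wt y *s (x *v (x *v w)) - (2 * wt (bracket x y)) *s (x *v w)
      + wt (bracket x (bracket x y)) *s w" if "y \<in> h" for y
    using bracket_mult_vec[of x y "x *v w"] y1[OF that] y1[OF h[OF that]]
    by (simp add: vector_scalar_commute matrix_vector_mult_diff_distrib vec_eq_iff algebra_simps)
  let ?c = "wt (bracket x y)"
  show ?thesis
    using w
  proof (cases rule: krylov_cases[where x = x])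
    case (one a)
    then have "bracket x y *v w = 0"
      using wt[OF y] by (simp add: bracket_mult_vec vector_scalar_commute mult.commute)
    then show ?thesis using wt[OF h[OF y]] w by auto
  next
    case (two a b)
    have "bracket x y *v (x *v w) = (b * ?c) *s w - ?c *s (x *v w)"
      unfolding bracket_mult_vec two(1) y1[OF y]
      by (simp add: vector_scalar_commute matrix_vector_mult_diff_distrib matrix_vector_right_distrib y1[OF y] wt[OF y] two(1) vec_eq_iff algebra_simps)
    with y1[OF h[OF y]] have "(b * ?c + wt (bracket x (bracket x y))) *s w + (- 2 * ?c) *s (x *v w) = 0"
      by (simp add: vec_eq_iff algebra_simps)
    then show ?thesis using two(2) by fastforce
  next
    case (three a b c)
    let ?d = "wt (bracket x (bracket x y))"
    let ?e = "wt (bracket x (bracket x (bracket x y)))"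
    have "bracket x y *v (x *v (x *v w)) = (b * ?c - c * ?d) *s w + (?d + 2 * c * ?c) *s (x *v w)
        - (2 * ?c) *s (x *v (x *v w))"
      unfolding bracket_mult_vec three(1) y2[OF y]
      by (simp add: vector_scalar_commute matrix_vector_mult_diff_distrib matrix_vector_right_distrib
            y1[OF y] y2[OF y] wt[OF y] three(1))
         (simp add: vec_eq_iff algebra_simps)
    with y2[OF h[OF y]] have "(b * ?c - c * ?d - ?e) *s w + (3 * ?d + 2 * c * ?c) *s (x *v w)
        + (- 3 * ?c) *s (x *v (x *v w)) = 0"
      by (simp add: vec_eq_iff algebra_simps)
    then show ?thesis using three(2) by fastforce
  qed
qed

section \<open>Derived series and ideals of codimension one\<close>

lemma derived_algebra_mono: "v \<subseteq> w \<Longrightarrow> derived_algebra v \<subseteq> derived_algebra w"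
  unfolding derived_algebra_def by (rule span_mono) blast

lemma derived_algebra_subset:
  "subspace v \<Longrightarrow> (\<And>x y. x \<in> v \<Longrightarrow> y \<in> v \<Longrightarrow> bracket x y \<in> v) \<Longrightarrow> derived_algebra v \<subseteq> v"
  unfolding derived_algebra_def by (rule span_minimal) auto

lemma derived_algebra_funpow_mono:
  "v \<subseteq> w \<Longrightarrow> (derived_algebra ^^ n) v \<subseteq> (derived_algebra ^^ n) w"
  by (induction n) (auto dest: derived_algebra_mono)

lemma subspace_derived_algebra_funpow: "subspace v \<Longrightarrow> subspace ((derived_algebra ^^ n) v)"
  by (cases n) (auto simp: derived_algebra_def)

lemma solvable_lie_subset:
  assumes "solvable_lie w" "v \<subseteq> w" "subspace v"
  shows "solvable_lie v"
proof -
  obtain n where n: "(derived_algebra ^^ n) w = {0}"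
    using assms(1) by (auto simp: solvable_lie_def)
  have "(derived_algebra ^^ n) v = {0}"
    using derived_algebra_funpow_mono[OF assms(2), of n] n
      subspace_0[OF subspace_derived_algebra_funpow[OF assms(3), of n]] by blast
  then show ?thesis by (auto simp: solvable_lie_def)
qed

lemma solvable_lie_derived_neq:
  assumes "solvable_lie v" "v \<noteq> {0}"
  shows "derived_algebra v \<noteq> v"
proof
  assume eq: "derived_algebra v = v"
  have "(derived_algebra ^^ n) v = v" for n
    by (induction n) (auto simp: eq)
  then show False using assms by (auto simp: solvable_lie_def)
qed

text \<open>Extend a basis of \<open>D\<close> to a basis of \<open>L\<close> and drop one of the
  added vectors, \<open>x\<close>. When \<open>D\<close> is the derived algebra of \<open>L\<close>,
  every subspace between them is an ideal, so this supplies the smaller algebra for an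
  induction.\<close>

lemma hyperplane_between:
  fixes D L :: "'a::euclidean_space set"
  assumes "subspace D" "subspace L" "D \<subseteq> L" "D \<noteq> L"
  obtains h x where "subspace h" "D \<subseteq> h" "h \<subseteq> L" "x \<in> L" "dim h < dim L"
    "\<And>z. z \<in> L \<Longrightarrow> \<exists>k. z - k *\<^sub>R x \<in> h"
proof -
  obtain B where B: "B \<subseteq> D" "independent B" "D \<subseteq> span B"
    by (metis basis_exists)
  obtain C where C: "B \<subseteq> C" "C \<subseteq> L" "independent C" "L \<subseteq> span C"
    using maximal_independent_subset_extend[of B L] subset_trans[OF B(1) assms(3)] B(2) by metis
  have "B \<noteq> C"
    using C(4) assms(1,3,4) B(1) span_minimal by blast
  then obtain x where x: "x \<in> C" "x \<notin> B" using C(1) by blast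
  let ?h = "span (C - {x})"
  have "dim ?h = card (C - {x})"
    using independent_mono[OF C(3), of "C - {x}"] by (simp add: dim_eq_card_independent)
  also have "\<dots> < card C"
    using x C(3) by (intro psubset_card_mono) (auto simp: independent_imp_finite)
  also have "card C = dim L"
    using C by (simp add: basis_card_eq_dim)
  finally have "dim ?h < dim L" .
  moreover have "D \<subseteq> ?h"
    using B(3) C(1) x span_mono[of B "C - {x}"] by blast
  moreover have "?h \<subseteq> L"
    using C(2) assms(2) by (intro span_minimal) auto
  moreover have "\<exists>k. z - k *\<^sub>R x \<in> ?h" if "z \<in> L" for z
    using that C(4) x(1) span_breakdown[of x C z] by blast
  ultimately show thesis using that[of ?h x] x C(2) by auto
qed

text \<open>Induction on the real dimension of \<open>L\<close>. A hyperplane ideal \<open>h\<close>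
  has a common eigenvector in \<open>W\<close>; its whole weight space is stable under the missing
  direction \<open>x\<close>, which therefore has an eigenvector there.\<close>

theorem common_eigenvector_of_solvable:
  assumes "subspace L" "\<And>x y. x \<in> L \<Longrightarrow> y \<in> L \<Longrightarrow> bracket x y \<in> L" "solvable_lie L"
    and "vec.subspace W" "w \<in> W" "w \<noteq> 0" "\<And>x u. x \<in> L \<Longrightarrow> u \<in> W \<Longrightarrow> x *v u \<in> W"
  shows "\<exists>u\<in>W. u \<noteq> 0 \<and> (\<forall>x\<in>L. \<exists>r. x *v u = r *s u)"
  using assms(1-3,7)
proof (induction "dim L" arbitrary: L rule: less_induct)
  case less
  show ?case
  proof (cases "L = {0}")
    case True
    have "\<exists>r. (0::cmat3) *v w = r *s w"
      by (rule exI[of _ 0]) simp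
    with True assms(5,6) show ?thesis by auto
  next
    case False
    let ?D = "derived_algebra L"
    have br: "bracket x y \<in> ?D" if "x \<in> L" "y \<in> L" for x y
      unfolding derived_algebra_def using that by (auto intro: span_base)
    have "?D \<noteq> L" "?D \<subseteq> L" "subspace ?D"
      using solvable_lie_derived_neq False less.prems derived_algebra_subset
      by (auto simp: derived_algebra_def)
    then obtain h x where h: "subspace h" "?D \<subseteq> h" "h \<subseteq> L" and x: "x \<in> L"
      and dim: "dim h < dim L" and hx: "\<And>z. z \<in> L \<Longrightarrow> \<exists>k. z - k *\<^sub>R x \<in> h"
      using hyperplane_between less.prems(1) by metis
    have hbr: "bracket x y \<in> h" if "x \<in> h" "y \<in> h" for x y
      using br h that by blast
    have "\<exists>u\<in>W. u \<noteq> 0 \<and> (\<forall>x\<in>h. \<exists>r. x *v u = r *s u)"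
      using h hbr less.prems
      by (intro less.hyps[OF dim]) (auto intro: solvable_lie_subset)
    then obtain u0 wt where u0: "u0 \<in> W" "u0 \<noteq> 0" and wt: "\<And>y. y \<in> h \<Longrightarrow> y *v u0 = wt y *s u0"
      by metis
    define W' where "W' = {u \<in> W. \<forall>y\<in>h. y *v u = wt y *s u}"
    have "vec.subspace W'"
      using assms(4) unfolding W'_def vec.subspace_def
      by (auto simp: matrix_vector_right_distrib vector_scalar_commute vec.scale_right_distrib mult.commute)
    moreover have "x *v u \<in> W'" if "u \<in> W'" for u
    proof (cases "u = 0")
      case True
      then show ?thesis using that by simp
    next
      case False
      have "y *v (x *v u) = wt y *s (x *v u)" if y: "y \<in> h" for y
      proof -
        have u: "z *v u = wt z *s u" if "z \<in> h" for z
          using that \<open>u \<in> W'\<close> by (auto simp: W'_def)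
        \<comment> \<open>The vanishing weight makes \<open>bracket x y\<close> kill
          \<open>u\<close>, so \<open>y\<close> acts on \<open>x *v u\<close> by the same scalar as
          on \<open>u\<close>.\<close>
        have "wt (bracket x y) = 0"
          using x y h br u False
          by (intro weight_bracket_eq_0[where h = h and w = u]) auto
        then have "bracket x y *v u = 0"
          using u[of "bracket x y"] x y h br by auto
        then show ?thesis
          by (simp add: bracket_mult_vec u[OF y] vector_scalar_commute)
      qed
      then show ?thesis using that x less.prems(4) by (auto simp: W'_def)
    qed
    moreover have "u0 \<in> W'" using u0 wt by (auto simp: W'_def)
    ultimately obtain u r where u: "u \<in> W'" "u \<noteq> 0" "x *v u = r *s u"
      using eigenvector_in_invariant_subspace[of W' x u0] u0(2) by blast
    have "\<exists>r. z *v u = r *s u" if z: "z \<in> L" for z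
    proof -
      \<comment> \<open>Modulo \<open>h\<close>, every element is a real multiple of
        \<open>x\<close>, and \<open>u\<close> is an eigenvector of both summands.\<close>
      obtain k where k: "z - k *\<^sub>R x \<in> h" using hx[OF z] by blast
      let ?y = "z - k *\<^sub>R x"
      have "z *v u = ?y *v u + (k *\<^sub>R x) *v u"
        by (simp add: matrix_vector_mult_diff_rdistrib)
      also have "\<dots> = wt ?y *s u + (of_real k * r) *s u"
        using u k by (auto simp: W'_def scaleR_mult_vec)
      finally show ?thesis
        by (metis vec.scale_left_distrib)
    qed
    then show ?thesis using u by (auto simp: W'_def)
  qed
qed

section \<open>The group and its action\<close>

lemma N_nth: "N $ i $ j = (if i = j then if i = 3 then -1 else 1 else 0)"
  by (simp add: N_def)

lemma N_mult_N: "N ** N = mat 1"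
  by (simp add: mat3_eq_iff mult_mat_nth3 N_nth mat_def)

text \<open>For square matrices a one-sided inverse is two-sided, so the inverse picked by choice is
  determined.\<close>

lemma matrix_inv_eqI:
  fixes A :: "'a::field^'n^'n"
  assumes "A ** B = mat 1"
  shows "matrix_inv A = B"
proof -
  have BA: "B ** A = mat 1" using assms matrix_left_right_inverse by blast
  have "A ** matrix_inv A = mat 1"
    unfolding matrix_inv_def by (rule someI2[of _ B]) (use assms BA in auto)
  then show ?thesis
    by (metis BA matrix_mul_assoc matrix_mul_lid matrix_mul_rid)
qed

lemma matrix_inv_N: "matrix_inv N = N"
  by (rule matrix_inv_eqI) (rule N_mult_N)

lemma ctranspose_nth: "ctranspose x $ i $ j = cnj (x $ j $ i)"
  by (simp add: ctranspose_def transpose_def map_matrix_def)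

lemma ctranspose_mult: "ctranspose (x ** y) = ctranspose y ** ctranspose x"
  by (simp add: vec_eq_iff ctranspose_nth mult_mat_nth3 mult.commute)

lemma ctranspose_ctranspose: "ctranspose (ctranspose x) = x"
  by (simp add: vec_eq_iff ctranspose_nth)

lemma ctranspose_N: "ctranspose N = N"
  by (simp add: vec_eq_iff ctranspose_nth N_nth)

lemma det_ctranspose: "det (ctranspose x) = cnj (det x)"
  by (simp add: det_3 ctranspose_nth algebra_simps)

lemma uminus_mult_mat: "(- x) ** y = - (x ** y)" for x :: "'a::comm_ring_1^3^3"
  by (simp add: vec_eq_iff mult_mat_nth3 algebra_simps)

lemma mult_mat_uminus: "x ** (- y) = - (x ** y)" for x :: "'a::comm_ring_1^3^3"
  by (simp add: vec_eq_iff mult_mat_nth3 algebra_simps)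

lemma diff_mult_mat: "(x - y) ** z = x ** z - y ** z" for x :: "'a::comm_ring_1^3^3"
  by (simp add: vec_eq_iff mult_mat_nth3 algebra_simps)

lemma add_mult_mat: "(x + y) ** z = x ** z + y ** z" for x :: "'a::comm_ring_1^3^3"
  by (simp add: vec_eq_iff mult_mat_nth3 algebra_simps)

lemma mult_mat_diff: "x ** (y - z) = x ** y - x ** z" for x :: "'a::comm_ring_1^3^3"
  by (simp add: vec_eq_iff mult_mat_nth3 algebra_simps)

lemma trace_mult_commute: "trace (x ** y) = trace (y ** x)" for x :: cmat3
  by (simp add: trace_def sum_3 mult_mat_nth3 algebra_simps)

lemma su21_iff: "x \<in> su21 \<longleftrightarrow> trace x = 0 \<and> ctranspose x ** N = - (N ** x)"
proof -
  have "- (N ** ctranspose x ** N) = x \<longleftrightarrow> N ** ctranspose x ** N = - x"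
    by (metis minus_minus)
  also have "\<dots> \<longleftrightarrow> ctranspose x ** N = - (N ** x)"
    by (metis N_mult_N matrix_mul_assoc matrix_mul_lid mult_mat_uminus)
  finally show ?thesis by (simp add: su21_def matrix_inv_N)
qed

lemma su21_iff_entries: "x \<in> su21 \<longleftrightarrow> x$1$1 + x$2$2 + x$3$3 = 0 \<and>
    cnj (x$1$1) = - x$1$1 \<and> cnj (x$2$2) = - x$2$2 \<and> cnj (x$3$3) = - x$3$3 \<and>
    x$2$1 = - cnj (x$1$2) \<and> x$3$1 = cnj (x$1$3) \<and> x$3$2 = cnj (x$2$3)"
  unfolding su21_iff
  by (simp add: trace_def sum_3 mat3_eq_iff mult_mat_nth3 ctranspose_nth N_nth)
     (auto simp: complex_eq_iff)

text \<open>The adjoint for the Hermitian form with matrix \<open>N\<close>; it is the inverse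
  exactly on the unitary group of that form.\<close>

definition SU21_inv :: "cmat3 \<Rightarrow> cmat3" where
  "SU21_inv g = N ** ctranspose g ** N"

text \<open>Membership becomes a set of equations in the entries and their conjugates, which can be
  checked on explicit matrices.\<close>

lemma SU21_iff: "g \<in> SU21 \<longleftrightarrow> det g = 1 \<and> SU21_inv g ** g = mat 1"
proof -
  have "N ** matrix_inv (ctranspose g) ** N = g \<longleftrightarrow> SU21_inv g ** g = mat 1" if "det g = 1"
  proof
    assume eq: "N ** matrix_inv (ctranspose g) ** N = g"
    have "invertible (ctranspose g)"
      using that by (simp add: invertible_det_nz det_ctranspose)
    then obtain B where B: "ctranspose g ** B = mat 1"
      by (auto simp: invertible_def)
    then have "g = N ** B ** N" using eq matrix_inv_eqI by metis
    then have "SU21_inv g ** g = N ** (ctranspose g ** ((N ** N) ** B)) ** N"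
      by (simp only: SU21_inv_def matrix_mul_assoc)
    then show "SU21_inv g ** g = mat 1"
      by (simp add: N_mult_N B)
  next
    assume "SU21_inv g ** g = mat 1"
    then have "N ** (ctranspose g ** N ** g) = mat 1"
      by (simp add: SU21_inv_def matrix_mul_assoc)
    then have "(ctranspose g ** N ** g) ** N = mat 1"
      by (simp add: matrix_left_right_inverse)
    then have "matrix_inv (ctranspose g) = N ** g ** N"
      by (intro matrix_inv_eqI) (simp add: matrix_mul_assoc)
    then have "N ** matrix_inv (ctranspose g) ** N = (N ** N) ** g ** (N ** N)"
      by (simp only: matrix_mul_assoc)
    then show "N ** matrix_inv (ctranspose g) ** N = g"
      by (simp add: N_mult_N)
  qed
  then show ?thesis by (auto simp: SU21_def matrix_inv_N)
qed

lemma SU21_inv_left: "g \<in> SU21 \<Longrightarrow> SU21_inv g ** g = mat 1"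
  and SU21_inv_right: "g \<in> SU21 \<Longrightarrow> g ** SU21_inv g = mat 1"
  using matrix_left_right_inverse by (auto simp: SU21_iff)

lemma matrix_inv_SU21: "g \<in> SU21 \<Longrightarrow> matrix_inv g = SU21_inv g"
  by (intro matrix_inv_eqI SU21_inv_right)

lemma SU21_inv_mult: "SU21_inv (g ** h) = SU21_inv h ** SU21_inv g"
proof -
  have "SU21_inv h ** SU21_inv g = N ** ctranspose h ** (N ** N) ** ctranspose g ** N"
    by (simp only: SU21_inv_def matrix_mul_assoc)
  then show ?thesis
    by (simp add: N_mult_N SU21_inv_def ctranspose_mult matrix_mul_assoc)
qed

lemma SU21_inv_SU21_inv: "SU21_inv (SU21_inv g) = g"
proof -
  have "SU21_inv (SU21_inv g) = (N ** N) ** g ** (N ** N)"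
    by (simp only: SU21_inv_def ctranspose_mult ctranspose_N ctranspose_ctranspose matrix_mul_assoc)
  then show ?thesis by (simp add: N_mult_N)
qed

lemma SU21_mult: assumes "g \<in> SU21" "h \<in> SU21" shows "g ** h \<in> SU21"
proof -
  have "SU21_inv (g ** h) ** (g ** h) = SU21_inv h ** (SU21_inv g ** g) ** h"
    by (simp only: SU21_inv_mult matrix_mul_assoc)
  then show ?thesis
    using assms SU21_inv_left by (auto simp: SU21_iff[of "g ** h"] det_mul) (auto simp: SU21_iff)
qed

lemma SU21_inv_in_SU21: assumes "g \<in> SU21" shows "SU21_inv g \<in> SU21"
proof -
  have "det (SU21_inv g) * det g = 1"
    using SU21_inv_left[OF assms] by (metis det_I det_mul)
  then show ?thesis
    using assms SU21_inv_right[OF assms] by (simp add: SU21_iff SU21_inv_SU21_inv)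
qed

abbreviation conj_by :: "cmat3 \<Rightarrow> cmat3 \<Rightarrow> cmat3" where
  "conj_by g x \<equiv> g ** x ** SU21_inv g"

lemma act_SU21: "g \<in> SU21 \<Longrightarrow> act g v = conj_by g ` v"
  by (simp add: act_def matrix_inv_SU21)

lemma conj_by_mult: "conj_by (g ** h) x = conj_by g (conj_by h x)"
  by (simp add: SU21_inv_mult matrix_mul_assoc)

lemma conj_by_inv:
  assumes "g \<in> SU21" shows "conj_by (SU21_inv g) (conj_by g x) = x"
proof -
  have "conj_by (SU21_inv g) (conj_by g x) = (SU21_inv g ** g) ** x ** (SU21_inv g ** g)"
    by (simp only: SU21_inv_SU21_inv matrix_mul_assoc)
  then show ?thesis using SU21_inv_left[OF assms] by simp
qed

lemma mult_conj_by:
  assumes "g \<in> SU21" shows "conj_by g x ** conj_by g y = conj_by g (x ** y)"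
proof -
  have "conj_by g x ** conj_by g y = g ** x ** (SU21_inv g ** g) ** y ** SU21_inv g"
    by (simp only: matrix_mul_assoc)
  then show ?thesis using SU21_inv_left[OF assms] by (simp add: matrix_mul_assoc)
qed

lemma trace_conj_by:
  assumes "g \<in> SU21" shows "trace (conj_by g x) = trace x"
proof -
  have "trace (conj_by g x) = trace ((SU21_inv g ** g) ** x)"
    by (metis trace_mult_commute matrix_mul_assoc)
  then show ?thesis using SU21_inv_left[OF assms] by simp
qed

lemma bracket_conj_by:
  "g \<in> SU21 \<Longrightarrow> bracket (conj_by g x) (conj_by g y) = conj_by g (bracket x y)"
  by (simp add: bracket_def mult_conj_by diff_mult_mat mult_mat_diff)

lemma linear_conj_by: "linear (conj_by g)"
  by (rule linearI)
     (simp_all add: matrix_add_ldistrib add_mult_mat mult_mat_scaleR_left mult_mat_scaleR_right)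

lemma conj_by_su21:
  assumes g: "g \<in> SU21" and x: "x \<in> su21" shows "conj_by g x \<in> su21"
proof -
  let ?h = "SU21_inv g"
  \<comment> \<open>The two intertwining identities move \<open>N\<close> past the conjugate
    transposes, turning skewness of \<open>x\<close> into skewness of its conjugate.\<close>
  have 1: "ctranspose g ** N = N ** ?h"
    by (simp add: SU21_inv_def matrix_mul_assoc N_mult_N)
  have "ctranspose ?h ** N = N ** SU21_inv ?h"
    by (simp add: SU21_inv_def matrix_mul_assoc N_mult_N)
  then have 2: "ctranspose ?h ** N = N ** g"
    by (simp add: SU21_inv_SU21_inv)
  have "ctranspose (conj_by g x) ** N = ctranspose ?h ** (ctranspose x ** (ctranspose g ** N))"
    by (simp add: ctranspose_mult matrix_mul_assoc)
  also have "\<dots> = ctranspose ?h ** (ctranspose x ** N) ** ?h"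
    by (simp only: 1 matrix_mul_assoc)
  also have "\<dots> = - ((ctranspose ?h ** N) ** x ** ?h)"
    using x by (simp add: su21_iff matrix_mul_assoc uminus_mult_mat mult_mat_uminus)
  also have "\<dots> = - (N ** conj_by g x)"
    by (simp only: 2 matrix_mul_assoc)
  finally show ?thesis
    using g x by (simp add: su21_iff trace_conj_by)
qed

lemma act_mult: "g \<in> SU21 \<Longrightarrow> h \<in> SU21 \<Longrightarrow> act (g ** h) v = act g (act h v)"
  by (simp add: act_SU21 SU21_mult image_image conj_by_mult)

lemma act_inv: "g \<in> SU21 \<Longrightarrow> act (SU21_inv g) (act g v) = v"
  by (simp add: act_SU21 SU21_inv_in_SU21 image_image conj_by_inv)

lemma conjugate_SU21_sym: "conjugate_SU21 v w \<Longrightarrow> conjugate_SU21 w v"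
  unfolding conjugate_SU21_def using act_inv SU21_inv_in_SU21 by blast

lemma conjugate_SU21_trans: "conjugate_SU21 u v \<Longrightarrow> conjugate_SU21 v w \<Longrightarrow> conjugate_SU21 u w"
  unfolding conjugate_SU21_def using act_mult SU21_mult by metis

lemma derived_algebra_act:
  assumes "g \<in> SU21" shows "derived_algebra (act g v) = act g (derived_algebra v)"
proof -
  have "{bracket x y |x y. x \<in> act g v \<and> y \<in> act g v} = conj_by g ` {bracket x y |x y. x \<in> v \<and> y \<in> v}"
    unfolding act_SU21[OF assms]
    by (auto simp: bracket_conj_by[OF assms] intro!: imageI)
       (blast, intro exI conjI, rule bracket_conj_by[OF assms, symmetric], auto)
  then show ?thesis
    using assms linear_span_image[OF linear_conj_by] by (simp add: derived_algebra_def act_SU21)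
qed

lemma solvable_lie_act:
  assumes "g \<in> SU21" "solvable_lie v" shows "solvable_lie (act g v)"
proof -
  have "(derived_algebra ^^ n) (act g v) = act g ((derived_algebra ^^ n) v)" for n
    by (induction n) (auto simp: derived_algebra_act assms(1))
  moreover have "act g {0} = {0}"
    using linear_0[OF linear_conj_by] assms(1) by (simp add: act_SU21)
  ultimately show ?thesis using assms(2) unfolding solvable_lie_def by metis
qed

lemma solvable_subalgebra3_act:
  assumes g: "g \<in> SU21" and v: "solvable_subalgebra3 v" shows "solvable_subalgebra3 (act g v)"
proof -
  have "inj (conj_by g)"
    by (rule inj_on_inverseI[of _ "conj_by (SU21_inv g)"]) (rule conj_by_inv[OF g])
  then have "dim (act g v) = dim v"
    unfolding act_SU21[OF g] by (intro dim_image_eq linear_conj_by) (rule inj_on_subset, auto)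
  moreover have "subspace (act g v)"
    using g v by (simp add: act_SU21 linear_subspace_image[OF linear_conj_by]
        solvable_subalgebra3_def lie_subalgebra_su21_def)
  moreover have "act g v \<subseteq> su21"
    using g v conj_by_su21 by (auto simp: act_SU21 solvable_subalgebra3_def lie_subalgebra_su21_def)
  moreover have "\<forall>x\<in>act g v. \<forall>y\<in>act g v. bracket x y \<in> act g v"
    using g v by (auto simp: act_SU21 bracket_conj_by solvable_subalgebra3_def lie_subalgebra_su21_def)
  ultimately show ?thesis
    using solvable_lie_act[OF g] v by (simp add: solvable_subalgebra3_def lie_subalgebra_su21_def)
qed

section \<open>The invariant Hermitian form\<close>

definition herm :: "complex^3 \<Rightarrow> complex^3 \<Rightarrow> complex" where
  "herm u w = u$1 * cnj (w$1) + u$2 * cnj (w$2) - u$3 * cnj (w$3)"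

lemma herm_add_left: "herm (u + v) w = herm u w + herm v w"
  and herm_diff_left: "herm (u - v) w = herm u w - herm v w"
  and herm_smult_left: "herm (c *s u) w = c * herm u w"
  and herm_smult_right: "herm u (c *s w) = cnj c * herm u w"
  and herm_zero_left: "herm 0 w = 0"
  by (simp_all add: herm_def algebra_simps)

lemma herm_commute: "herm w u = cnj (herm u w)"
  by (simp add: herm_def)

lemma herm_orthogonal_commute: "herm u w = 0 \<Longrightarrow> herm w u = 0"
  using herm_commute[of w u] by simp

lemma herm_su21:
  assumes "x \<in> su21" shows "herm (x *v u) w = - herm u (x *v w)"
proof -
  have e: "cnj (x$1$1) = - x$1$1" "cnj (x$2$2) = - x$2$2" "cnj (x$3$3) = - x$3$3"
    "x$2$1 = - cnj (x$1$2)" "x$3$1 = cnj (x$1$3)" "x$3$2 = cnj (x$2$3)"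
    using assms by (auto simp: su21_iff_entries)
  show ?thesis by (simp add: herm_def mult_vec_nth3 e algebra_simps)
qed

lemma subspace_herm_orthogonal: "vec.subspace {u. \<forall>w\<in>S. herm u w = 0}"
  by (auto simp: vec.subspace_def herm_add_left herm_smult_left herm_zero_left)

text \<open>Skewness moves \<open>x\<close> onto the second argument, where it acts by a
  scalar.\<close>

lemma herm_orthogonal_invariant:
  assumes "x \<in> su21" "\<forall>w\<in>S. herm u w = 0" "\<And>w. w \<in> S \<Longrightarrow> \<exists>r. x *v w = r *s w"
  shows "\<forall>w\<in>S. herm (x *v u) w = 0"
proof
  fix w assume w: "w \<in> S"
  then obtain r where "x *v w = r *s w" using assms(3) by blast
  then show "herm (x *v u) w = 0"
    using assms(2) w by (simp add: herm_su21[OF assms(1)] herm_smult_right)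
qed

lemma exists_notin_span:
  fixes S :: "('a::field^3) set"
  assumes "finite S" "card S < 3"
  obtains u where "u \<notin> vec.span S"
proof -
  have d: "vec.dim (UNIV :: ('a^3) set) = 3" unfolding vec_dim_card by simp
  have "vec.dim S < 3" using assms vec.dim_le_card'[of S] by simp
  then have "vec.span S \<noteq> UNIV"
    using vec.dim_span[of S] d by (metis less_irrefl)
  then show thesis using that by blast
qed

text \<open>Gram-Schmidt: the projection onto \<open>w1\<close> makes sense because
  \<open>w1\<close> is not null, and the result is nonzero because \<open>v\<close> lies outside the
  span.\<close>

lemma exists_herm_orthogonal1:
  assumes "herm w1 w1 \<noteq> 0"
  obtains u where "u \<noteq> 0" "herm u w1 = 0"
proof -
  obtain v where v: "v \<notin> vec.span {w1}" by (rule exists_notin_span[of "{w1}"]) auto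
  let ?c = "herm v w1 / herm w1 w1"
  let ?u = "v - ?c *s w1"
  have "?u \<noteq> 0"
  proof
    assume "?u = 0"
    then have "v = ?c *s w1" by simp
    then show False using v by (metis vec.span_base vec.span_scale insertI1)
  qed
  moreover have "herm ?u w1 = 0"
    using assms by (simp add: herm_diff_left herm_smult_left)
  ultimately show thesis using that by blast
qed

lemma exists_herm_orthogonal2:
  assumes "herm w1 w1 \<noteq> 0" "herm w2 w2 \<noteq> 0" "herm w1 w2 = 0"
  obtains u where "u \<noteq> 0" "herm u w1 = 0" "herm u w2 = 0"
proof -
  have "card {w1, w2} < 3" by (rule le_less_trans[OF card_insert_le_m1]) auto
  then obtain v where v: "v \<notin> vec.span {w1, w2}" by (rule exists_notin_span[of "{w1, w2}", rotated]) auto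
  let ?c = "herm v w1 / herm w1 w1" and ?d = "herm v w2 / herm w2 w2"
  let ?u = "v - ?c *s w1 - ?d *s w2"
  have "?u \<noteq> 0"
  proof
    assume "?u = 0"
    then have "v = ?c *s w1 + ?d *s w2" by (simp add: algebra_simps)
    moreover have "?c *s w1 + ?d *s w2 \<in> vec.span {w1, w2}"
      by (intro vec.span_add vec.span_scale vec.span_base) auto
    ultimately show False using v by metis
  qed
  moreover have "herm ?u w1 = 0" "herm ?u w2 = 0"
    using assms herm_orthogonal_commute[OF assms(3)]
    by (simp_all add: herm_diff_left herm_smult_left)
  ultimately show thesis using that by blast
qed

text \<open>Orthogonal non-null vectors form a basis, in which \<open>x\<close> is diagonal with
  entries 0, 0, \<open>r\<close>; trace zero forces \<open>r = 0\<close>.\<close>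

lemma su21_eq_0_if_kills_orthogonal_pair:
  assumes x: "trace x = 0" "x *v w1 = 0" "x *v w2 = 0" "x *v w3 = r *s w3"
    and nonnull: "herm w1 w1 \<noteq> 0" "herm w2 w2 \<noteq> 0" "herm w3 w3 \<noteq> 0"
    and orth: "herm w1 w2 = 0" "herm w1 w3 = 0" "herm w2 w3 = 0"
  shows "x = 0"
proof -
  define M :: cmat3 where "M = transpose (vector [w1, w2, w3])"
  have M: "M $ i $ 1 = w1 $ i" "M $ i $ 2 = w2 $ i" "M $ i $ 3 = w3 $ i" for i
    by (simp_all add: M_def transpose_def)
  let ?G = "ctranspose M ** N ** M"
  have G: "?G $ i $ 1 = herm w1 (column i M)" "?G $ i $ 2 = herm w2 (column i M)"
    "?G $ i $ 3 = herm w3 (column i M)" for i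
    by (simp_all add: mult_mat_nth3 ctranspose_nth N_nth M herm_def column_def algebra_simps)
  have col: "column 1 M = w1" "column 2 M = w2" "column 3 M = w3"
    by (simp_all add: vec_eq_iff column_def M)
  \<comment> \<open>\<open>?G\<close> is the Gram matrix of the three vectors, diagonal by
    orthogonality; its invertibility passes to \<open>M\<close>.\<close>
  have "det ?G \<noteq> 0"
    using nonnull orth orth[THEN herm_orthogonal_commute] by (simp add: det_3 G col)
  then have "invertible M"
    by (simp add: det_mul invertible_det_nz)
  then obtain B where B: "M ** B = mat 1" "B ** M = mat 1"
    by (auto simp: invertible_def)
  define E :: cmat3 where "E = (\<chi> i j. if i = 3 \<and> j = 3 then r else 0)"
  have xw: "(x *v w1) $ i = 0" "(x *v w2) $ i = 0" "(x *v w3) $ i = r * w3 $ i" for i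
    using x by simp_all
  have xM: "x ** M = M ** E"
    using xw by (simp add: mat3_eq_iff mult_mat_nth3 mult_vec_nth3 M E_def mult.commute)
  have "x = x ** M ** B"
    by (simp add: B flip: matrix_mul_assoc)
  then have xeq: "x = M ** E ** B" by (simp add: xM)
  have "trace x = trace (B ** M ** E)"
    unfolding xeq by (metis trace_mult_commute matrix_mul_assoc)
  then have "r = 0"
    using x(1) by (simp add: B trace_def sum_3 E_def)
  then have "E = 0" by (simp add: E_def vec_eq_iff)
  then show ?thesis by (simp add: xeq)
qed

theorem null_common_eigenvector:
  assumes v: "solvable_subalgebra3 v"
  shows "\<exists>u. u \<noteq> 0 \<and> herm u u = 0 \<and> (\<forall>x\<in>v. \<exists>r. x *v u = r *s u)"
proof (rule ccontr)
  let ?eig = "\<lambda>u. \<forall>x\<in>v. \<exists>r. x *v u = r *s u"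
  assume "\<not> ?thesis"
  then have nonnull: "herm u u \<noteq> 0" if "u \<noteq> 0" "?eig u" for u using that by blast
  have sub: "subspace v" and su: "\<And>x. x \<in> v \<Longrightarrow> x \<in> su21" and dim: "dim v = 3"
    and br: "\<And>x y. x \<in> v \<Longrightarrow> y \<in> v \<Longrightarrow> bracket x y \<in> v" and solv: "solvable_lie v"
    using v by (auto simp: solvable_subalgebra3_def lie_subalgebra_su21_def)
  \<comment> \<open>Lie's theorem inside the orthogonal complement of \<open>S\<close>; the vector
    \<open>u\<close> witnesses that this complement is nonzero.\<close>
  have eig: "\<exists>w. w \<noteq> 0 \<and> (\<forall>s\<in>S. herm w s = 0) \<and> ?eig w"
    if "\<And>s. s \<in> S \<Longrightarrow> ?eig s" "u \<noteq> 0" "\<forall>s\<in>S. herm u s = 0" for S u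
  proof -
    have "\<exists>w\<in>{u. \<forall>s\<in>S. herm u s = 0}. w \<noteq> 0 \<and> ?eig w"
    proof (rule common_eigenvector_of_solvable[OF sub br solv subspace_herm_orthogonal])
      show "u \<in> {u. \<forall>s\<in>S. herm u s = 0}" "u \<noteq> 0" using that by auto
      show "x *v w \<in> {u. \<forall>s\<in>S. herm u s = 0}" if "x \<in> v" "w \<in> {u. \<forall>s\<in>S. herm u s = 0}" for x w
        using herm_orthogonal_invariant[OF su[OF that(1)], of S w] that \<open>\<And>s. s \<in> S \<Longrightarrow> ?eig s\<close> by blast
    qed
    then show ?thesis by blast
  qed
  obtain w1 where w1: "w1 \<noteq> 0" "?eig w1"
    using eig[of "{}" "axis 1 1"] by (auto simp: axis_eq_0_iff)
  obtain u2 where "u2 \<noteq> 0" "herm u2 w1 = 0"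
    using exists_herm_orthogonal1 nonnull[OF w1] by blast
  then obtain w2 where w2: "w2 \<noteq> 0" "?eig w2" "herm w2 w1 = 0"
    using eig[of "{w1}" u2] w1(2) by auto
  obtain u3 where "u3 \<noteq> 0" "herm u3 w1 = 0" "herm u3 w2 = 0"
    using exists_herm_orthogonal2[of w1 w2] nonnull w1 w2 herm_orthogonal_commute by blast
  then obtain w3 where w3: "w3 \<noteq> 0" "?eig w3" "herm w3 w1 = 0" "herm w3 w2 = 0"
    using eig[of "{w1, w2}" u3] w1(2) w2(2) by auto
  \<comment> \<open>Imaginary eigenvalues with sum zero are determined by two of them, but
    \<open>f\<close> maps the three-dimensional \<open>v\<close> into a real plane and so has a
    nonzero kernel element.\<close>
  define f where "f x = (Im (herm (x *v w1) w1), Im (herm (x *v w2) w2))" for x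
  have "linear f"
    by (rule linearI) (simp_all add: f_def matrix_vector_mult_add_rdistrib scaleR_mult_vec
        herm_add_left herm_smult_left)
  have "\<not> inj_on f v"
  proof
    assume "inj_on f v"
    then have "dim (f ` v) = 3"
      using dim_image_eq[OF \<open>linear f\<close>, of v] sub dim by (metis span_eq_iff)
    then show False
      using dim_subset_UNIV[of "f ` v"] by simp
  qed
  then obtain x where x: "x \<in> v" "f x = 0" "x \<noteq> 0"
    using linear_injective_on_subspace_0[OF \<open>linear f\<close> sub] by blast
  have kill: "x *v w = 0" if w: "?eig w" "w \<noteq> 0" "Im (herm (x *v w) w) = 0" for w
  proof -
    obtain r where r: "x *v w = r *s w" using w(1) x(1) by blast
    \<comment> \<open>Skewness together with Hermitian symmetry makes this number purely
      imaginary.\<close>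
    have "herm (x *v w) w = - cnj (herm (x *v w) w)"
      using herm_su21[OF su[OF x(1)], of w w] herm_commute[of w "x *v w"] by simp
    then have "herm (x *v w) w = 0"
      using w(3) by (simp add: complex_eq_iff)
    then have "r = 0" using nonnull[OF w(2,1)] by (simp add: r herm_smult_left)
    then show ?thesis by (simp add: r)
  qed
  obtain r where r: "x *v w3 = r *s w3" using w3 x by blast
  have "x = 0"
    using su[OF x(1)] kill[OF w1(2,1)] kill[OF w2(2,1)] x(2) r nonnull[OF w1] nonnull[OF w2(1,2)]
      nonnull[OF w3(1,2)] w2(3) w3(3,4)
    by (intro su21_eq_0_if_kills_orthogonal_pair[of x w1 w2 w3 r])
       (auto simp: su21_iff f_def zero_prod_def intro: herm_orthogonal_commute)
  with x(3) show False by simp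
qed

section \<open>The stabiliser of a null line\<close>

text \<open>The matrix \<open>a A5 + m (A1 - A2) + n(c) + z Z\<close> with \<open>Z = A1 + A2 - A6\<close> central in the nilradical; these
  are the elements of \<open>su21\<close> for which \<open>(1, 0, 1)\<close> is an eigenvector.\<close>
definition bmat :: "real \<Rightarrow> real \<Rightarrow> complex \<Rightarrow> real \<Rightarrow> cmat3" where
  "bmat a m c z = vector [vector [\<i> * (m + z), c, a - \<i> * z],
                           vector [- cnj c, - 2 * \<i> * m, cnj c],
                           vector [a + \<i> * z, c, \<i> * (m - z)]]"

lemma bmat_nth:
  "bmat a m c z $ 1 $ 1 = \<i> * (m + z)" "bmat a m c z $ 1 $ 2 = c" "bmat a m c z $ 1 $ 3 = a - \<i> * z"
  "bmat a m c z $ 2 $ 1 = - cnj c" "bmat a m c z $ 2 $ 2 = - 2 * \<i> * m" "bmat a m c z $ 2 $ 3 = cnj c"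
  "bmat a m c z $ 3 $ 1 = a + \<i> * z" "bmat a m c z $ 3 $ 2 = c" "bmat a m c z $ 3 $ 3 = \<i> * (m - z)"
  by (simp_all add: bmat_def)

lemma bmat_eq_iff:
  "bmat a m c z = bmat a' m' c' z' \<longleftrightarrow> a = a' \<and> m = m' \<and> c = c' \<and> z = z'"
proof
  assume eq: "bmat a m c z = bmat a' m' c' z'"
  have "bmat a m c z $ i $ j = bmat a' m' c' z' $ i $ j" for i j by (simp add: eq)
  from this[of 1 2] this[of 1 3] this[of 2 2] show "a = a' \<and> m = m' \<and> c = c' \<and> z = z'"
    by (simp add: bmat_nth complex_eq_iff)
qed auto

lemma bmat_add: "bmat a m c z + bmat a' m' c' z' = bmat (a + a') (m + m') (c + c') (z + z')"
  by (simp add: mat3_eq_iff bmat_nth algebra_simps)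

lemma bmat_scaleR: "k *\<^sub>R bmat a m c z = bmat (k * a) (k * m) (of_real k * c) (k * z)"
  by (simp add: mat3_eq_iff bmat_nth complex_eq_iff algebra_simps)

lemma bmat_0: "bmat 0 0 0 0 = 0"
  by (simp add: mat3_eq_iff bmat_nth)

lemma bmat_su21: "bmat a m c z \<in> su21"
  by (simp add: su21_iff_entries bmat_nth algebra_simps)

text \<open>The torus part acts on the \<open>c\<close>-coordinate as multiplication by
  \<open>Complex a (3 * m)\<close> and on the \<open>z\<close>-coordinate as multiplication by
  \<open>2 * a\<close>; the term with \<open>Im\<close> is the Heisenberg cocycle.\<close>

lemma bracket_bmat:
  "bracket (bmat a m c z) (bmat a' m' c' z') =
     bmat 0 0 (Complex a (3 * m) * c' - Complex a' (3 * m') * c)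
       (2 * (a * z' - a' * z) - 2 * Im (c * cnj c'))"
  by (simp add: bracket_def mat3_eq_iff bmat_nth mult_mat_nth3 complex_eq_iff)
     (simp add: algebra_simps)

lemma Complex_0_0: "Complex 0 0 = 0"
  by (simp add: complex_eq_iff)

lemma trace_bmat_sq: "trace (bmat a m c z ** bmat a m c z) = of_real (2 * a^2 - 6 * m^2)"
  by (simp add: trace_def sum_3 bmat_nth mult_mat_nth3 complex_eq_iff power2_eq_square algebra_simps)

text \<open>The eigenvector equation equates the first and third row sums over columns 1 and 3 and
  annihilates the second; together with the symmetries of \<open>su21\<close> only \<open>a\<close>,
  \<open>m\<close>, \<open>c\<close>, \<open>z\<close> remain free. The eigenvalue is
  \<open>a + i m\<close>.\<close>

lemma su21_stabiliser_bmat: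
  assumes "x \<in> su21" "x *v vector [1, 0, 1] = r *s vector [1, 0, 1]"
  shows "\<exists>a m c z. x = bmat a m c z"
proof -
  have "x = bmat (Re (x$1$3)) ((Im (x$1$1) + Im (x$3$3)) / 2) (x$1$2) ((Im (x$1$1) - Im (x$3$3)) / 2)"
    using assms
    by (simp add: su21_iff_entries mat3_eq_iff bmat_nth vec3_eq_iff mult_vec_nth3 complex_eq_iff) argo
  then show ?thesis by blast
qed

text \<open>\<open>unip e\<close> is the exponential of \<open>bmat 0 0 e 0\<close>, whose cube vanishes.\<close>
definition unip :: "complex \<Rightarrow> cmat3" where
  "unip e = vector [vector [1 - e * cnj e / 2, e, e * cnj e / 2],
                    vector [- cnj e, 1, cnj e],
                    vector [- (e * cnj e) / 2, e, 1 + e * cnj e / 2]]"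

text \<open>For \<open>e\<close> on the unit circle, the one-parameter group generated by
  \<open>bmat 0 1 0 0\<close>.\<close>

definition torus :: "complex \<Rightarrow> cmat3" where
  "torus e = vector [vector [e, 0, 0], vector [0, (cnj e)^2, 0], vector [0, 0, e]]"

text \<open>When the squared moduli of \<open>a\<close> and \<open>b\<close> sum to 1, an element of
  SU(2) acting on the first two coordinates; it sends \<open>(1, 0, 1)\<close> to
  \<open>(a, b, 1)\<close>.\<close>

definition rot :: "complex \<Rightarrow> complex \<Rightarrow> cmat3" where
  "rot a b = vector [vector [a, - cnj b, 0], vector [b, cnj a, 0], vector [0, 0, 1]]"

text \<open>Carries the line of \<open>(1, 0, 1)\<close> to that of
  \<open>(1, -1, - sqrt 2)\<close>, a null line preserved by \<open>v33\<close>. The entry -1 in the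
  corner corrects the determinant of the reflection.\<close>

definition refl45 :: cmat3 where
  "refl45 = vector [vector [1 / sqrt 2, - 1 / sqrt 2, 0], vector [- 1 / sqrt 2, - 1 / sqrt 2, 0],
                    vector [0, 0, - 1]]"

text \<open>An intertwining relation is easier to check on explicit matrices than a triple
  product.\<close>

lemma conj_by_eqI:
  assumes "g \<in> SU21" "g ** x = y ** g" shows "conj_by g x = y"
proof -
  have "conj_by g x = y ** (g ** SU21_inv g)"
    by (simp add: assms(2) matrix_mul_assoc)
  then show ?thesis using SU21_inv_right[OF assms(1)] by simp
qed

lemma SU21_inv_nth: "SU21_inv g $ i $ j = (if (i = 3) = (j = 3) then 1 else -1) * cnj (g $ j $ i)"
proof -
  have "\<forall>i j. SU21_inv g $ i $ j = (if (i = 3) = (j = 3) then 1 else -1) * cnj (g $ j $ i)"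
    by (simp add: forall_3 SU21_inv_def mult_mat_nth3 N_nth ctranspose_nth)
  then show ?thesis by blast
qed

lemma unip_SU21: "unip e \<in> SU21"
  by (simp add: SU21_iff det_3 mat3_eq_iff mult_mat_nth3 SU21_inv_nth unip_def mat_def)
     (simp add: field_simps)

text \<open>With \<open>e = c / Complex a (3 * m)\<close> the \<open>c\<close>-coordinate
  disappears, while \<open>a\<close> and \<open>m\<close> never change.\<close>

lemma conj_by_unip:
  "conj_by (unip e) (bmat a m c z) =
     bmat a m (c - Complex a (3 * m) * e) (z - 2 * Im (e * cnj c) - 3 * m * Re (e * cnj e))"
  by (rule conj_by_eqI[OF unip_SU21])
     (simp add: mat3_eq_iff mult_mat_nth3 unip_def bmat_nth complex_eq_iff field_simps)

lemma torus_SU21: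
  assumes "e * cnj e = 1" shows "torus e \<in> SU21"
proof -
  have "cnj e * e = 1" using assms by (simp add: mult.commute)
  then have "(e * e) * (cnj e)^2 = 1" "e^2 * (cnj e)^2 = 1"
    by (simp_all add: power2_eq_square, algebra+)
  then show ?thesis using assms \<open>cnj e * e = 1\<close>
    by (simp add: SU21_iff det_3 mat3_eq_iff mult_mat_nth3 SU21_inv_nth torus_def mat_def mult_ac)
qed

lemma conj_by_torus:
  assumes "e * cnj e = 1"
  shows "conj_by (torus e) (bmat a m c z) = bmat a m (e^3 * c) z"
proof (rule conj_by_eqI[OF torus_SU21[OF assms]])
  have 1: "e * (e * ((cnj e)^2 * w)) = w" "e^3 * (cnj e)^2 = e" "e * (cnj e)^3 = (cnj e)^2" for w
    using assms by algebra+
  show "torus e ** bmat a m c z = bmat a m (e^3 * c) z ** torus e"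
    using 1
    by (simp add: mat3_eq_iff mult_mat_nth3 torus_def bmat_nth mult_ac)
qed

lemma rot_SU21:
  assumes "a * cnj a + b * cnj b = 1" shows "rot a b \<in> SU21"
  using assms
  by (simp add: SU21_iff det_3 mat3_eq_iff mult_mat_nth3 SU21_inv_nth rot_def mat_def algebra_simps)

lemma refl45_SU21: "refl45 \<in> SU21"
  by (simp add: SU21_iff det_3 mat3_eq_iff mult_mat_nth3 SU21_inv_nth refl45_def mat_def)
     (simp flip: of_real_mult)

lemmas A_defs = A1_def A2_def A3_def A4_def A5_def A6_def A7_def A8_def

lemma A_bmat: "A4 - A8 = bmat 0 0 \<i> 0" "A3 + A7 = bmat 0 0 1 0" "A1 + A2 - A6 = bmat 0 0 0 1"
  "A3 + A4 + A7 - A8 = bmat 0 0 (1 + \<i>) 0" "A5 = bmat 1 0 0 0"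
  by (simp_all add: mat3_eq_iff bmat_nth A_defs i_times_def matrix_unit_def map_matrix_def)

lemma conj_by_refl45:
  "conj_by refl45 (bmat 1 0 0 0) = (- 1 / sqrt 2) *\<^sub>R (A5 - A7)"
  "conj_by refl45 (bmat 0 1 0 0) = (- 1 / 2) *\<^sub>R (A1 + 2 *\<^sub>R A2 + 3 *\<^sub>R A4)"
  "conj_by refl45 (bmat 0 0 0 1) = (1 / 2) *\<^sub>R (A1 + 2 *\<^sub>R A2 + 3 *\<^sub>R A4)
     - (1 / 2) *\<^sub>R (4 *\<^sub>R A4 - sqrt 2 *\<^sub>R A6 + sqrt 2 *\<^sub>R A8)"
  by (rule conj_by_eqI[OF refl45_SU21];
      simp add: mat3_eq_iff mult_mat_nth3 refl45_def bmat_nth A_defs i_times_def matrix_unit_def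
        map_matrix_def complex_eq_iff field_simps)+

section \<open>Three-dimensional subalgebras of the stabiliser\<close>

definition borel_subalgebra :: "cmat3 set" where
  "borel_subalgebra = {bmat a m c z | a m c z. True}"

text \<open>\<open>heis\<close>, \<open>solv_line\<close> and \<open>solv_torus\<close> are the
  models of the three types: \<open>v31\<close> is \<open>heis\<close>, \<open>v32\<close> is a
  \<open>solv_line\<close>, and \<open>v33\<close> is conjugate to
  \<open>solv_torus\<close>.\<close>

definition heis :: "cmat3 set" where
  "heis = range (\<lambda>(c, z). bmat 0 0 c z)"

definition solv_line :: "complex \<Rightarrow> cmat3 set" where
  "solv_line c = range (\<lambda>(a, t, z). bmat a 0 (of_real t * c) z)"

definition solv_torus :: "cmat3 set" where
  "solv_torus = range (\<lambda>(a, m, z). bmat a m 0 z)"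

lemma bmat_in_heis: "bmat a m c z \<in> heis \<longleftrightarrow> a = 0 \<and> m = 0"
  by (auto simp: heis_def bmat_eq_iff image_iff)

lemma bmat_in_solv_line: "bmat a m c z \<in> solv_line d \<longleftrightarrow> m = 0 \<and> (\<exists>t. c = of_real t * d)"
  by (auto simp: solv_line_def bmat_eq_iff image_iff)

lemma bmat_in_solv_torus: "bmat a m c z \<in> solv_torus \<longleftrightarrow> c = 0"
  by (auto simp: solv_torus_def bmat_eq_iff image_iff)

lemma range_linear_inj:
  fixes f :: "'a::euclidean_space \<Rightarrow> cmat3"
  assumes "linear f" "inj f"
  shows "subspace (range f)" "dim (range f) = DIM('a)"
proof -
  show "subspace (range f)"
    using linear_subspace_image[OF assms(1) subspace_UNIV] .
  have "inj_on f (span UNIV)"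
    using assms(2) by (rule inj_on_subset) auto
  then show "dim (range f) = DIM('a)"
    using dim_image_eq[OF assms(1)] dim_UNIV by metis
qed

lemma heis_dim: "subspace heis" "dim heis = 3"
proof -
  have lin: "linear (\<lambda>(c, z). bmat 0 0 c z)"
    by (rule linearI) (auto simp: bmat_add bmat_scaleR scaleR_conv_of_real[of _ "_ :: complex"] split: prod.split)
  have inj: "inj (\<lambda>(c, z). bmat 0 0 c z)"
    by (auto simp: inj_def bmat_eq_iff)
  show "subspace heis" "dim heis = 3"
    using range_linear_inj[OF lin inj] by (simp_all add: heis_def)
qed

lemma solv_line_dim:
  assumes "c \<noteq> 0" shows "subspace (solv_line c)" "dim (solv_line c) = 3"
proof -
  have lin: "linear (\<lambda>(a, t, z). bmat a 0 (of_real t * c) z)"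
    by (rule linearI) (auto simp: bmat_add bmat_scaleR algebra_simps split: prod.split)
  have inj: "inj (\<lambda>(a, t, z). bmat a 0 (of_real t * c) z)"
    using assms by (auto simp: inj_def bmat_eq_iff)
  show "subspace (solv_line c)" "dim (solv_line c) = 3"
    using range_linear_inj[OF lin inj] by (simp_all add: solv_line_def)
qed

lemma solv_torus_dim: "subspace solv_torus" "dim solv_torus = 3"
proof -
  have lin: "linear (\<lambda>(a, m, z). bmat a m 0 z)"
    by (rule linearI) (auto simp: bmat_add bmat_scaleR split: prod.split)
  have inj: "inj (\<lambda>(a, m, z). bmat a m 0 z)"
    by (auto simp: inj_def bmat_eq_iff)
  show "subspace solv_torus" "dim solv_torus = 3"
    using range_linear_inj[OF lin inj] by (simp_all add: solv_torus_def)
qed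

lemma derived_algebra_subset_subspace:
  "subspace w \<Longrightarrow> (\<And>x y. x \<in> v \<Longrightarrow> y \<in> v \<Longrightarrow> bracket x y \<in> w) \<Longrightarrow> derived_algebra v \<subseteq> w"
  unfolding derived_algebra_def by (rule span_minimal) auto

text \<open>The derived series descends into the Heisenberg algebra, then into its centre
  \<open>range (bmat 0 0 0)\<close>, then to zero.\<close>

lemma solvable_lie_bmat:
  assumes "v \<subseteq> borel_subalgebra" shows "solvable_lie v"
proof -
  have sub: "subspace (range (bmat 0 0 0))"
    by (rule linear_subspace_image[OF _ subspace_UNIV], rule linearI)
       (auto simp: bmat_add bmat_scaleR)
  have "derived_algebra v \<subseteq> heis"
  proof (rule derived_algebra_subset_subspace[OF heis_dim(1)])
    fix x y assume "x \<in> v" "y \<in> v"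
    then have "x \<in> borel_subalgebra" "y \<in> borel_subalgebra" using assms by auto
    then show "bracket x y \<in> heis"
      by (auto simp: borel_subalgebra_def bracket_bmat bmat_in_heis)
  qed
  moreover have "bracket x y \<in> range (bmat 0 0 0)" if "x \<in> heis" "y \<in> heis" for x y
    using that by (auto simp: heis_def bracket_bmat Complex_0_0)
  ultimately have "derived_algebra (derived_algebra v) \<subseteq> range (bmat 0 0 0)"
    by (intro derived_algebra_subset_subspace sub) blast
  moreover have "bracket x y = 0" if "x \<in> range (bmat 0 0 0)" "y \<in> range (bmat 0 0 0)" for x y
    using that by (auto simp: bracket_bmat Complex_0_0 bmat_0)
  ultimately have "derived_algebra (derived_algebra (derived_algebra v)) \<subseteq> {0}"
    by (intro derived_algebra_subset_subspace subspace_single_0) blast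
  moreover have "0 \<in> derived_algebra (derived_algebra (derived_algebra v))"
    unfolding derived_algebra_def by (rule span_zero)
  ultimately have "(derived_algebra ^^ 3) v = {0}"
    by (auto simp: numeral_3_eq_3)
  then show ?thesis by (auto simp: solvable_lie_def)
qed

lemma solvable_subalgebra3_bmatI:
  assumes "subspace v" "dim v = 3" "v \<subseteq> borel_subalgebra" "\<And>x y. x \<in> v \<Longrightarrow> y \<in> v \<Longrightarrow> bracket x y \<in> v"
  shows "solvable_subalgebra3 v"
proof -
  have "v \<subseteq> su21" using assms(3) bmat_su21 by (auto simp: borel_subalgebra_def)
  then show ?thesis
    using assms solvable_lie_bmat by (auto simp: solvable_subalgebra3_def lie_subalgebra_su21_def)
qed

lemma solvable_subalgebra3_heis: "solvable_subalgebra3 heis"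
  by (rule solvable_subalgebra3_bmatI[OF heis_dim])
     (auto simp: heis_def borel_subalgebra_def bracket_bmat bmat_in_heis[unfolded heis_def])

lemma solvable_subalgebra3_solv_line:
  assumes "c \<noteq> 0" shows "solvable_subalgebra3 (solv_line c)"
proof (rule solvable_subalgebra3_bmatI[OF solv_line_dim[OF assms]])
  show "solv_line c \<subseteq> borel_subalgebra"
    by (auto simp: solv_line_def borel_subalgebra_def)
  fix x y assume "x \<in> solv_line c" "y \<in> solv_line c"
  then obtain a t z a' t' z' where "x = bmat a 0 (of_real t * c) z" "y = bmat a' 0 (of_real t' * c) z'"
    by (auto simp: solv_line_def)
  moreover have "Complex r 0 = of_real r" for r by (simp add: complex_eq_iff)
  ultimately show "bracket x y \<in> solv_line c"
    by (auto simp: bracket_bmat bmat_in_solv_line algebra_simps intro!: exI[of _ "a * t' - a' * t"])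
qed

lemma solvable_subalgebra3_solv_torus: "solvable_subalgebra3 solv_torus"
  by (rule solvable_subalgebra3_bmatI[OF solv_torus_dim])
     (auto simp: solv_torus_def borel_subalgebra_def bracket_bmat bmat_in_solv_torus[unfolded solv_torus_def])

text \<open>Equal dimensions reduce an identification to one inclusion.\<close>

lemma solvable_subalgebra3_eqI:
  assumes "solvable_subalgebra3 v" "v \<subseteq> w" "subspace w" "dim w = 3"
  shows "v = w"
  using assms subspace_dim_equal[of v w] by (auto simp: solvable_subalgebra3_def lie_subalgebra_su21_def)

text \<open>If \<open>c\<close> and \<open>c'\<close> are independent over the reals, the bracket
  supplies the centre and real combinations supply every \<open>c\<close>-coordinate.\<close>

lemma heis_subset:
  assumes sub: "subspace v" and br: "\<And>x y. x \<in> v \<Longrightarrow> y \<in> v \<Longrightarrow> bracket x y \<in> v"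
    and y1: "bmat 0 0 c z \<in> v" and y2: "bmat 0 0 c' z' \<in> v" and D: "Im (c * cnj c') \<noteq> 0"
  shows "heis \<subseteq> v"
proof
  fix x assume "x \<in> heis"
  then obtain w y where x: "x = bmat 0 0 w y" by (auto simp: heis_def)
  \<comment> \<open>Cramer's rule: up to sign \<open>D'\<close> is the determinant of
    \<open>c\<close>, \<open>c'\<close> as real vectors, \<open>s\<close> and \<open>t\<close> are
    the coordinates of \<open>w\<close>, and \<open>k\<close> corrects the central
    coordinate.\<close>
  define D' where "D' = Im (c * cnj c')"
  define s where "s = Im (w * cnj c') / D'"
  define t where "t = Im (c * cnj w) / D'"
  define k where "k = (s * z + t * z' - y) / (2 * D')"
  have D': "D' \<noteq> 0" using D by (simp add: D'_def)
  have "bmat 0 0 0 (- 2 * D') \<in> v"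
    using br[OF y1 y2] by (simp add: bracket_bmat Complex_0_0 D'_def)
  then have "s *\<^sub>R bmat 0 0 c z + t *\<^sub>R bmat 0 0 c' z' + k *\<^sub>R bmat 0 0 0 (- 2 * D') \<in> v"
    by (intro subspace_add[OF sub] subspace_scale[OF sub] y1 y2)
  moreover have "of_real s * c + of_real t * c' = w"
    using D' unfolding s_def t_def by (simp add: complex_eq_iff field_simps) (simp add: D'_def algebra_simps)
  moreover have "s * z + t * z' + k * (- 2 * D') = y"
    using D' by (simp add: k_def)
  ultimately show "x \<in> v" by (simp add: bmat_add bmat_scaleR x)
qed

lemma conj_by_in_act:
  assumes "g \<in> SU21" "x \<in> v" shows "conj_by g x \<in> act g v"
  using assms by (auto simp: act_SU21)

text \<open>Otherwise \<open>v\<close> contains \<open>heis\<close>, equals it by dimension, and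
  could not contain the given element with nonzero torus part.\<close>

lemma commuting_if_not_heis:
  assumes v: "solvable_subalgebra3 v" and x: "bmat a m c z \<in> v" "a \<noteq> 0 \<or> m \<noteq> 0"
    and y: "bmat 0 0 c1 z1 \<in> v" "bmat 0 0 c2 z2 \<in> v"
  shows "Im (c1 * cnj c2) = 0"
proof (rule ccontr)
  assume "Im (c1 * cnj c2) \<noteq> 0"
  then have "heis \<subseteq> v"
    using heis_subset[OF _ _ y] v by (auto simp: solvable_subalgebra3_def lie_subalgebra_su21_def)
  then have "heis = v"
    using v by (intro solvable_subalgebra3_eqI[OF solvable_subalgebra3_heis])
       (auto simp: solvable_subalgebra3_def lie_subalgebra_su21_def)
  then show False using x bmat_in_heis by blast
qed

lemma real_multiple_if_Im_eq_0:
  assumes "Im (c1 * cnj c2) = 0" "c1 \<noteq> 0"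
  shows "\<exists>t. c2 = of_real t * c1"
proof -
  have "c2 / c1 = of_real (Re (c2 / c1))"
    using assms(1) by (simp add: complex_eq_iff Im_divide mult.commute)
  then show ?thesis using assms(2) by (metis nonzero_eq_divide_eq)
qed

lemma borel_subalgebra_cases:
  assumes v: "solvable_subalgebra3 v" and vb: "v \<subseteq> borel_subalgebra"
  shows "v = heis \<or> (\<exists>g\<in>SU21. act g v = solv_torus \<or> (\<exists>c. c \<noteq> 0 \<and> act g v = solv_line c))"
proof (cases "v \<subseteq> heis")
  case True
  then show ?thesis using solvable_subalgebra3_eqI[OF v] heis_dim by blast
next
  case False
  then obtain p where p: "p \<in> v" "p \<notin> heis" by blast
  \<comment> \<open>An element with \<open>m\<close> nonzero is preferred; if there is none,
    \<open>m\<close> vanishes on all of \<open>v\<close>, as the case \<open>m = 0\<close>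
    requires.\<close>
  obtain a m c z where x: "bmat a m c z \<in> v" "a \<noteq> 0 \<or> m \<noteq> 0"
      and m: "m = 0 \<Longrightarrow> \<forall>a' m' c' z'. bmat a' m' c' z' \<in> v \<longrightarrow> m' = 0"
  proof (cases "\<exists>a m c z. bmat a m c z \<in> v \<and> m \<noteq> 0")
    case True
    then show thesis using that by blast
  next
    case False
    obtain a m c z where "p = bmat a m c z"
      using p(1) vb by (auto simp: borel_subalgebra_def)
    then show thesis
      using that[of a m c z] p False bmat_in_heis[of a m c z] by blast
  qed
  define w where "w = Complex a (3 * m)"
  have w: "w \<noteq> 0" using x(2) by (auto simp: w_def complex_eq_iff)
  define g where "g = unip (c / w)"
  define u where "u = act g v"
  have g: "g \<in> SU21" by (simp add: g_def unip_SU21)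
  have u: "solvable_subalgebra3 u" unfolding u_def by (rule solvable_subalgebra3_act[OF g v])
  then have br: "bracket p q \<in> u" if "p \<in> u" "q \<in> u" for p q
    using that by (auto simp: solvable_subalgebra3_def lie_subalgebra_su21_def)
  have ub: "u \<subseteq> borel_subalgebra"
  proof
    fix p assume "p \<in> u"
    then obtain q where q: "q \<in> v" "p = conj_by g q" by (auto simp: u_def act_SU21[OF g])
    then obtain a1 m1 c1 z1 where "q = bmat a1 m1 c1 z1"
      using vb by (auto simp: borel_subalgebra_def)
    then show "p \<in> borel_subalgebra"
      using q(2) by (auto simp: borel_subalgebra_def g_def conj_by_unip)
  qed
  obtain z0 where x0: "bmat a m 0 z0 \<in> u"
    using conj_by_in_act[OF g x(1)] w by (simp add: u_def g_def conj_by_unip flip: w_def)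
  \<comment> \<open>Bracketing with the straightened element multiplies the
    \<open>c\<close>-coordinate by \<open>w\<close> and removes the torus part.\<close>
  have ad: "\<exists>z''. bmat 0 0 (w * c') z'' \<in> u" if "bmat a' m' c' z' \<in> u" for a' m' c' z'
    using br[OF x0 that] by (auto simp: bracket_bmat w_def)
  note comm = commuting_if_not_heis[OF u x0 x(2)]
  have "u = solv_torus \<or> (\<exists>c. c \<noteq> 0 \<and> u = solv_line c)"
  proof (cases "m = 0")
    case False
    have "c' = 0" if y: "bmat a' m' c' z' \<in> u" for a' m' c' z'
    proof -
      \<comment> \<open>The coordinates \<open>w * c'\<close> and \<open>w * (w * c')\<close> must
        be real-dependent by \<open>comm\<close>, but their ratio \<open>w\<close> has imaginary
        part \<open>3 * m\<close>, which is nonzero; hence \<open>c' = 0\<close>.\<close>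
      obtain z1 where z1: "bmat 0 0 (w * c') z1 \<in> u" using ad[OF y] by blast
      then obtain z2 where z2: "bmat 0 0 (w * (w * c')) z2 \<in> u" using ad by blast
      have "(w * c') * cnj (w * (w * c')) = of_real ((cmod (w * c'))\<^sup>2) * cnj w"
        by (simp only: complex_norm_square) (simp add: mult_ac)
      then have "(cmod (w * c'))\<^sup>2 * Im (cnj w) = 0"
        using comm[OF z1 z2] by (metis Im_complex_of_real Re_complex_of_real times_complex.simps(2) add.right_neutral mult_zero_left)
      then show ?thesis using False w by (simp add: w_def)
    qed
    then have "u \<subseteq> solv_torus"
      using ub unfolding borel_subalgebra_def by (auto simp: bmat_in_solv_torus)
    then show ?thesis
      using solvable_subalgebra3_eqI[OF u] solv_torus_dim by blast
  next
    case True
    have um: "m' = 0" if p: "bmat a' m' c' z' \<in> u" for a' m' c' z'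
    proof -
      obtain y where y: "y \<in> v" "conj_by g y = bmat a' m' c' z'"
        using p by (auto simp: u_def act_SU21[OF g])
      then obtain a1 m1 c1 z1 where "y = bmat a1 m1 c1 z1"
        using vb by (auto simp: borel_subalgebra_def)
      then show ?thesis
        using y m[OF True] by (auto simp: g_def conj_by_unip bmat_eq_iff)
    qed
    \<comment> \<open>Here \<open>m\<close> vanishes on \<open>u\<close>, whereas equality with
      \<open>solv_torus\<close>, forced by dimension, would give an element with
      \<open>m = 1\<close>.\<close>
    have "\<not> u \<subseteq> solv_torus"
    proof
      assume "u \<subseteq> solv_torus"
      then have "u = solv_torus" using solvable_subalgebra3_eqI[OF u] solv_torus_dim by blast
      then have "bmat 0 1 0 0 \<in> u" by (simp add: bmat_in_solv_torus)
      then show False using um by fastforce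
    qed
    then obtain a1 m1 c1 z1 where y1: "bmat a1 m1 c1 z1 \<in> u" "c1 \<noteq> 0"
      using ub unfolding borel_subalgebra_def by (auto simp: bmat_in_solv_torus subset_iff)
    have "\<exists>t. c2 = of_real t * c1" if y2: "bmat a2 m2 c2 z2 \<in> u" for a2 m2 c2 z2
    proof -
      \<comment> \<open>After multiplication by \<open>w\<close> all \<open>c\<close>-coordinates
        lie on one real line; dividing by \<open>w\<close> puts the original ones on the line of
        \<open>c1\<close>.\<close>
      have "Im ((w * c1) * cnj (w * c2)) = 0"
        using comm ad[OF y1(1)] ad[OF y2] by blast
      then obtain t where "w * c2 = of_real t * (w * c1)"
        using real_multiple_if_Im_eq_0[of "w * c1" "w * c2"] y1(2) w by auto
      then show ?thesis using w by (metis mult.left_commute mult_left_cancel)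
    qed
    then have "u \<subseteq> solv_line c1"
      using ub um unfolding borel_subalgebra_def by (auto simp: bmat_in_solv_line subset_iff)
    then show ?thesis
      using solvable_subalgebra3_eqI[OF u] solv_line_dim[OF y1(2)] y1(2) by blast
  qed
  then show ?thesis using g u_def by blast
qed

text \<open>Only the real line through \<open>c\<close> matters, and \<open>torus e\<close> rotates
  it by \<open>e ^ 3\<close>; a cube root of the phase of \<open>d / c\<close> aligns the two
  lines.\<close>

lemma solv_line_conjugate:
  assumes "c \<noteq> 0" "d \<noteq> 0" shows "conjugate_SU21 (solv_line c) (solv_line d)"
proof -
  define e where "e = cis (Arg (d / c) / 3)"
  have e: "e * cnj e = 1" by (simp add: e_def cis_mult cis_cnj)
  have "d / c = of_real (cmod (d / c)) * cis (Arg (d / c))"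
    by (metis rcis_cmod_Arg rcis_def)
  then have "d / c = of_real (cmod (d / c)) * e ^ 3"
    by (simp add: e_def Complex.DeMoivre)
  then have ec: "e ^ 3 * c = of_real (1 / cmod (d / c)) * d"
    using assms by (simp add: field_simps)
  have "e ^ 3 * (of_real t * c) = of_real (t * (1 / cmod (d / c))) * d" for t
  proof -
    have "e ^ 3 * (of_real t * c) = of_real t * (e ^ 3 * c)" by (simp only: mult_ac)
    then show ?thesis unfolding ec by simp
  qed
  then have "bmat a 0 (e ^ 3 * (of_real t * c)) z \<in> solv_line d" for a t z
    unfolding bmat_in_solv_line by blast
  then have "act (torus e) (solv_line c) \<subseteq> solv_line d"
    by (auto simp: act_SU21[OF torus_SU21[OF e]] solv_line_def[of c] conj_by_torus[OF e])
  then have "act (torus e) (solv_line c) = solv_line d"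
    using solvable_subalgebra3_eqI solvable_subalgebra3_act[OF torus_SU21[OF e]]
      solvable_subalgebra3_solv_line[OF assms(1)] solv_line_dim[OF assms(2)] by metis
  then show ?thesis using torus_SU21[OF e] by (auto simp: conjugate_SU21_def)
qed

section \<open>The given spans as models\<close>

lemma v31_eq: "v31 = heis"
proof -
  have "bmat 0 0 c z \<in> v31" for c z
  proof -
    have "Im c *\<^sub>R (A4 - A8) + Re c *\<^sub>R (A3 + A7) + z *\<^sub>R (A1 + A2 - A6) \<in> v31"
      unfolding v31_def by (intro span_add span_scale span_base) auto
    moreover have "of_real (Im c) * \<i> + of_real (Re c) = c" by (simp add: complex_eq_iff)
    ultimately show ?thesis by (simp add: A_bmat bmat_add bmat_scaleR)
  qed
  moreover have "v31 \<subseteq> heis"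
    unfolding v31_def by (rule span_minimal) (auto simp: A_bmat bmat_in_heis heis_dim)
  ultimately show ?thesis by (auto simp: heis_def)
qed

lemma v32_eq: "v32 = solv_line (1 + \<i>)"
proof -
  have "1 + \<i> \<noteq> 0" by (simp add: complex_eq_iff)
  have "bmat a 0 (of_real t * (1 + \<i>)) z \<in> v32" for a t z
  proof -
    have "t *\<^sub>R (A3 + A4 + A7 - A8) + z *\<^sub>R (A1 + A2 - A6) + a *\<^sub>R A5 \<in> v32"
      unfolding v32_def by (intro span_add span_scale span_base) auto
    then show ?thesis by (simp add: A_bmat bmat_add bmat_scaleR)
  qed
  moreover have "v32 \<subseteq> solv_line (1 + \<i>)"
    unfolding v32_def using solv_line_dim(1)[OF \<open>1 + \<i> \<noteq> 0\<close>]
    by (intro span_minimal) (auto simp: A_bmat bmat_in_solv_line intro: exI[of _ 0] exI[of _ 1])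
  ultimately show ?thesis by (auto simp: solv_line_def)
qed

lemma v33_eq: "v33 = act refl45 solv_torus"
proof -
  define X where "X = 4 *\<^sub>R A4 - sqrt 2 *\<^sub>R A6 + sqrt 2 *\<^sub>R A8"
  define Y where "Y = A5 - A7"
  define Z where "Z = A1 + 2 *\<^sub>R A2 + 3 *\<^sub>R A4"
  have v33: "v33 = span {X, Y, Z}" by (simp add: v33_def X_def Y_def Z_def)
  have lin: "linear (conj_by refl45)" by (rule linear_conj_by)
  have "conj_by refl45 (bmat a m 0 z) \<in> v33" for a m z
  proof -
    have "bmat a m 0 z = a *\<^sub>R bmat 1 0 0 0 + m *\<^sub>R bmat 0 1 0 0 + z *\<^sub>R bmat 0 0 0 1"
      by (simp add: bmat_add bmat_scaleR)
    then have eq: "conj_by refl45 (bmat a m 0 z) = a *\<^sub>R conj_by refl45 (bmat 1 0 0 0)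
        + m *\<^sub>R conj_by refl45 (bmat 0 1 0 0) + z *\<^sub>R conj_by refl45 (bmat 0 0 0 1)"
      by (simp only: linear_add[OF lin] linear_scale[OF lin])
    show ?thesis
      unfolding eq conj_by_refl45 v33 X_def[symmetric] Y_def[symmetric] Z_def[symmetric]
      by (intro span_add span_diff span_scale span_base) auto
  qed
  then have "act refl45 solv_torus \<subseteq> v33"
    by (auto simp: act_SU21[OF refl45_SU21] solv_torus_def)
  moreover have "subspace v33" by (simp add: v33_def)
  \<comment> \<open>The upper bound suffices: \<open>v33\<close> contains a conjugate of
    \<open>solv_torus\<close>, which already has dimension 3.\<close>
  moreover have "dim v33 \<le> 3"
  proof -
    have "dim v33 \<le> card {X, Y, Z}" unfolding v33 by (rule dim_le_card) auto
    also have "\<dots> \<le> 3" by (simp add: card_insert_if)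
    finally show ?thesis .
  qed
  ultimately show ?thesis
    using subspace_dim_equal[of "act refl45 solv_torus" v33]
      solvable_subalgebra3_act[OF refl45_SU21 solvable_subalgebra3_solv_torus]
    by (auto simp: solvable_subalgebra3_def lie_subalgebra_su21_def)
qed

text \<open>A nonzero null vector has nonzero third coordinate. Scaled to make it 1, its first two
  coordinates form a unit vector, the first column of some \<open>rot\<close>.\<close>

lemma null_vector_orbit:
  assumes "u \<noteq> 0" "herm u u = 0"
  obtains g s where "g \<in> SU21" "s \<noteq> 0" "g *v vector [1, 0, 1] = s *s u"
proof -
  have "complex_of_real ((cmod (u$1))\<^sup>2 + (cmod (u$2))\<^sup>2) = complex_of_real ((cmod (u$3))\<^sup>2)"
    using assms(2) unfolding of_real_add complex_norm_square herm_def by simp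
  then have n: "(cmod (u$1))\<^sup>2 + (cmod (u$2))\<^sup>2 = (cmod (u$3))\<^sup>2"
    by (simp only: of_real_eq_iff)
  have u3: "u$3 \<noteq> 0"
  proof
    assume "u$3 = 0"
    then have "u$1 = 0 \<and> u$2 = 0" using n by (simp add: sum_power2_eq_zero_iff)
    then show False using assms(1) \<open>u$3 = 0\<close> by (simp add: vec3_eq_iff)
  qed
  let ?a = "u$1 / u$3" and ?b = "u$2 / u$3"
  have "?a * cnj ?a + ?b * cnj ?b = of_real ((cmod ?a)\<^sup>2 + (cmod ?b)\<^sup>2)"
    by (simp only: complex_norm_square of_real_add)
  also have "(cmod ?a)\<^sup>2 + (cmod ?b)\<^sup>2 = ((cmod (u$1))\<^sup>2 + (cmod (u$2))\<^sup>2) / (cmod (u$3))\<^sup>2"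
    by (simp add: norm_divide power_divide add_divide_distrib)
  also have "\<dots> = 1" using n u3 by simp
  finally have "rot ?a ?b \<in> SU21" by (intro rot_SU21) simp
  moreover have "rot ?a ?b *v vector [1, 0, 1] = (1 / u$3) *s u"
    using u3 by (simp add: vec3_eq_iff mult_vec_nth3 rot_def)
  moreover have "1 / u$3 \<noteq> 0" using u3 by simp
  ultimately show thesis using that by blast
qed

lemma conjugate_into_borel_subalgebra:
  assumes v: "solvable_subalgebra3 v"
  shows "\<exists>g\<in>SU21. act g v \<subseteq> borel_subalgebra"
proof -
  let ?p = "vector [1, 0, 1] :: complex^3"
  obtain u where u: "u \<noteq> 0" "herm u u = 0" and eig: "\<And>x. x \<in> v \<Longrightarrow> \<exists>r. x *v u = r *s u"
    using null_common_eigenvector[OF v] by blast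
  obtain g s where g: "g \<in> SU21" and s: "s \<noteq> 0" and gp: "g *v ?p = s *s u"
    using null_vector_orbit[OF u] by blast
  let ?h = "SU21_inv g"
  have h: "?h \<in> SU21" by (rule SU21_inv_in_SU21[OF g])
  have "conj_by ?h x \<in> borel_subalgebra" if x: "x \<in> v" for x
  proof -
    obtain r where r: "x *v u = r *s u" using eig[OF x] by blast
    have xs: "x \<in> su21"
      using x v by (auto simp: solvable_subalgebra3_def lie_subalgebra_su21_def)
    \<comment> \<open>As \<open>g\<close> sends \<open>?p\<close> into the eigenline of
      \<open>u\<close>, conjugating by the inverse of \<open>g\<close> makes \<open>?p\<close> an
      eigenvector.\<close>
    have "conj_by ?h x *v ?p = ?h *v (x *v (g *v ?p))"
      by (simp add: SU21_inv_SU21_inv matrix_vector_mul_assoc matrix_mul_assoc)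
    also have "x *v (g *v ?p) = r *s (g *v ?p)"
      by (simp add: gp vector_scalar_commute r mult.commute)
    also have "?h *v (r *s (g *v ?p)) = r *s ?p"
      by (simp add: vector_scalar_commute matrix_vector_mul_assoc SU21_inv_left[OF g])
    finally show ?thesis
      using su21_stabiliser_bmat[OF conj_by_su21[OF h xs]] unfolding borel_subalgebra_def by blast
  qed
  then have "act ?h v \<subseteq> borel_subalgebra" by (auto simp: act_SU21[OF h])
  then show ?thesis using h by blast
qed

text \<open>The values of \<open>trace (x ** x)\<close> on a subalgebra are a conjugation invariant,
  used to separate the three types.\<close>

lemma conjugate_trace_sq:
  assumes "conjugate_SU21 v w" "y \<in> w"
  shows "\<exists>x\<in>v. trace (x ** x) = trace (y ** y)"
proof -
  obtain g where g: "g \<in> SU21" "act g v = w" using assms(1) by (auto simp: conjugate_SU21_def)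
  then obtain x where x: "x \<in> v" "y = conj_by g x" using assms(2) by (auto simp: act_SU21)
  then show ?thesis by (metis mult_conj_by[OF g(1)] trace_conj_by[OF g(1)])
qed

lemma conjugate_act: "g \<in> SU21 \<Longrightarrow> conjugate_SU21 v (act g v)"
  by (auto simp: conjugate_SU21_def)

theorem theorem6p4:
  shows "(solvable_subalgebra3 v31 \<and> solvable_subalgebra3 v32 \<and> solvable_subalgebra3 v33) \<and>
    (\<forall>v. solvable_subalgebra3 v \<longrightarrow>
       conjugate_SU21 v v31 \<or> conjugate_SU21 v v32 \<or> conjugate_SU21 v v33) \<and>
    \<not> conjugate_SU21 v31 v32 \<and> \<not> conjugate_SU21 v31 v33 \<and> \<not> conjugate_SU21 v32 v33"
proof (intro conjI allI impI)
  have i: "1 + \<i> \<noteq> 0" by (simp add: complex_eq_iff)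
  have torus: "conjugate_SU21 solv_torus v33"
    unfolding v33_eq by (rule conjugate_act[OF refl45_SU21])
  show "solvable_subalgebra3 v31"
    by (simp add: v31_eq solvable_subalgebra3_heis)
  show "solvable_subalgebra3 v32"
    by (simp add: v32_eq solvable_subalgebra3_solv_line[OF i])
  show "solvable_subalgebra3 v33"
    unfolding v33_eq by (rule solvable_subalgebra3_act[OF refl45_SU21 solvable_subalgebra3_solv_torus])
  show "conjugate_SU21 v v31 \<or> conjugate_SU21 v v32 \<or> conjugate_SU21 v v33"
    if v: "solvable_subalgebra3 v" for v
  proof -
    obtain g where g: "g \<in> SU21" and gv: "act g v \<subseteq> borel_subalgebra"
      using conjugate_into_borel_subalgebra[OF v] by blast
    have u: "conjugate_SU21 v (act g v)" by (rule conjugate_act[OF g])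
    consider "act g v = heis" | h where "h \<in> SU21" "act h (act g v) = solv_torus"
      | h c where "h \<in> SU21" "c \<noteq> 0" "act h (act g v) = solv_line c"
      using borel_subalgebra_cases[OF solvable_subalgebra3_act[OF g v] gv] by blast
    then show ?thesis
    proof cases
      case 1
      then show ?thesis using u by (simp add: v31_eq)
    next
      case 2
      then show ?thesis using u torus conjugate_act conjugate_SU21_trans by metis
    next
      case 3
      then show ?thesis
        using u solv_line_conjugate[OF 3(2) i] conjugate_act conjugate_SU21_trans unfolding v32_eq by metis
    qed
  qed
  have A5: "trace (bmat 1 0 0 0 ** bmat 1 0 0 0) = 2"
    by (simp add: trace_bmat_sq)
  have heis: "trace (x ** x) = 0" if "x \<in> heis" for x
    using that by (auto simp: heis_def trace_bmat_sq)
  show "\<not> conjugate_SU21 v31 v32"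
  proof
    assume c: "conjugate_SU21 v31 v32"
    have "bmat 1 0 0 0 \<in> v32" by (auto simp: v32_eq bmat_in_solv_line intro: exI[of _ 0])
    then show False using conjugate_trace_sq[OF c] heis A5 unfolding v31_eq by fastforce
  qed
  \<comment> \<open>Replacing \<open>v33\<close> by its model puts the trace computation in
    \<open>bmat\<close> coordinates.\<close>
  have sym: "conjugate_SU21 v solv_torus" if "conjugate_SU21 v v33" for v
    using that torus conjugate_SU21_sym conjugate_SU21_trans by blast
  show "\<not> conjugate_SU21 v31 v33"
  proof
    assume "conjugate_SU21 v31 v33"
    then have c: "conjugate_SU21 v31 solv_torus" by (rule sym)
    have "bmat 1 0 0 0 \<in> solv_torus" by (simp add: bmat_in_solv_torus)
    then show False using conjugate_trace_sq[OF c] heis A5 unfolding v31_eq by fastforce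
  qed
  show "\<not> conjugate_SU21 v32 v33"
  proof
    assume "conjugate_SU21 v32 v33"
    then have c: "conjugate_SU21 v32 solv_torus" by (rule sym)
    \<comment> \<open>The compact generator has trace form -6, whereas on \<open>v32\<close> the
      value is \<open>2 * a\<^sup>2\<close>.\<close>
    have "bmat 0 1 0 0 \<in> solv_torus" by (simp add: bmat_in_solv_torus)
    then obtain x where x: "x \<in> v32" "trace (x ** x) = trace (bmat 0 1 0 0 ** bmat 0 1 0 0)"
      using conjugate_trace_sq[OF c] by blast
    then obtain a where "complex_of_real (2 * a\<^sup>2) = complex_of_real (- 6)"
      by (auto simp: v32_eq solv_line_def trace_bmat_sq)
    then have "2 * a\<^sup>2 = - 6" by (simp only: of_real_eq_iff)
    then show False using zero_le_power2[of a] by linarith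
  qed
qed

end
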